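(* Let $n\ge1$ and let $h_0$ be the round metric of curvature 1 on $\mathbb S^{4n+3}$. There exists a neighborhood $\mathcal O$ of $h_0$ in the space of homogeneous ($\mathrm{Sp}(n+1)$-invariant) Riemannian metrics on $\mathbb S^{4n+3}$ such that for every $g_0\in\mathcal O$ there exist a constant $c>0$ and a Ricci iteration starting with $cg_0$, i.e. a sequence of Riemannian metrics $(g_i)_{i\ge1}$ on $\mathbb S^{4n+3}$ with $\operatorname{Ric} g_1=cg_0$ and $\operatorname{Ric} g_{i+1}=g_i$ for all $i\ge1$, which converges as $i\to\infty$ to a metric of constant curvature.
   Context: $\mathbb S^{4n+3}=\mathrm{Sp}(n+1)/\mathrm{Sp}(n)$ is the unit sphere in $\mathbb H^{n+1}$. The space of $\mathrm{Sp}(n+1)$-invariant metrics is topologized by identifying an invariant metric with its $\mathrm{Ad}(\mathrm{Sp}(n))$-invariant inner product on the tangent space at one point; these form an open cone in the finite-dimensional vector space of $\mathrm{Ad}(\mathrm{Sp}(n))$-invariant symmetric bilinear forms on that tangent space. $\operatorname{Ric} g$ is the Ricci $(0,2)$-tensor of $g$. *)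

theory Defs
  imports "HOL-Analysis.Analysis"
begin

subsection \<open>Quaternionic space and the compact symplectic group\<close>

text \<open>
  The pair \<open>(a, b)\<close> stands for the quaternion \<open>a + b j\<close>, where \<open>j z = cnj z * j\<close> for complex \<open>z\<close>.
  The library inner product on \<open>quat ^ 'm\<close> is the real part of the standard quaternionic Hermitian form.
\<close>

type_synonym quat = "complex \<times> complex"

definition qone :: quat where
  "qone = (1, 0)"

definition qmult :: "quat \<Rightarrow> quat \<Rightarrow> quat" where
  "qmult p q = (fst p * fst q - snd p * cnj (snd q), fst p * snd q + snd p * cnj (fst q))"

definition qcnj :: "quat \<Rightarrow> quat" where
  "qcnj p = (cnj (fst p), - snd p)"

text \<open>Matrices act on column vectors from the left, so scalars multiply vectors from the right.\<close>

definition qmat_vec :: "quat ^ 'm ^ 'm \<Rightarrow> quat ^ 'm \<Rightarrow> quat ^ 'm::finite" where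
  "qmat_vec A x = (\<chi> i. \<Sum>j\<in>UNIV. qmult (A $ i $ j) (x $ j))"

definition Sp :: "(quat ^ 'm ^ 'm::finite) set" where
  "Sp = {A. \<forall>i j. (\<Sum>k\<in>UNIV. qmult (qcnj (A $ k $ i)) (A $ k $ j)) = (if i = j then qone else 0)}"

subsection \<open>Smooth functions on open subsets of a Euclidean space\<close>

definition dir_deriv :: "('a::real_normed_vector \<Rightarrow> 'b::real_normed_vector) \<Rightarrow> 'a \<Rightarrow> 'a \<Rightarrow> 'b" where
  "dir_deriv f x v = vector_derivative (\<lambda>t. f (x + t *\<^sub>R v)) (at 0)"

primrec iter_dir_deriv ::
  "'a list \<Rightarrow> ('a::real_normed_vector \<Rightarrow> 'b::real_normed_vector) \<Rightarrow> 'a \<Rightarrow> 'b" where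
  "iter_dir_deriv [] f = f"
| "iter_dir_deriv (d # ds) f = (\<lambda>x. dir_deriv (iter_dir_deriv ds f) x d)"

text \<open>
  Meant for open \<open>U\<close>: all iterated partial derivatives are differentiable, hence continuous, so
  this is being of class C-infinity.
\<close>

definition smooth_on :: "'a::real_normed_vector set \<Rightarrow> ('a \<Rightarrow> 'b::real_normed_vector) \<Rightarrow> bool" where
  "smooth_on U f \<longleftrightarrow> (\<forall>ds. iter_dir_deriv ds f differentiable_on U)"

subsection \<open>Tensor fields of type (0,2) on the unit sphere\<close>

definition tangent :: "'a::euclidean_space \<Rightarrow> 'a set" where
  "tangent p = {v. v \<bullet> p = 0}"

definition tangent_proj :: "'a::euclidean_space \<Rightarrow> 'a \<Rightarrow> 'a" where
  "tangent_proj p v = v - (v \<bullet> p) *\<^sub>R p"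

text \<open>
  A tensor field \<open>g\<close> assigns to a point \<open>p\<close> of the sphere the form \<open>g p\<close> on the tangent space at
  \<open>p\<close>. Fields are extended by zero outside the sphere and outside the tangent spaces, so that
  equality of functions is equality of fields.
\<close>

type_synonym 'a tensor02 = "'a \<Rightarrow> 'a \<Rightarrow> 'a \<Rightarrow> real"

definition restrict_tensor :: "'a::euclidean_space tensor02 \<Rightarrow> 'a tensor02" where
  "restrict_tensor T =
     (\<lambda>p v w. if p \<in> sphere 0 1 \<and> v \<in> tangent p \<and> w \<in> tangent p then T p v w else 0)"

definition scale_tensor :: "real \<Rightarrow> 'a tensor02 \<Rightarrow> 'a tensor02" where
  "scale_tensor c T = (\<lambda>p v w. c * T p v w)"

definition radial :: "'a::euclidean_space \<Rightarrow> 'a" where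
  "radial x = x /\<^sub>R norm x"

text \<open>The pullback of a tensor field on the sphere along the retraction \<open>radial\<close> of \<open>- {0}\<close> onto it.\<close>

definition radial_pullback :: "'a::euclidean_space tensor02 \<Rightarrow> 'a tensor02" where
  "radial_pullback g x v w = g (radial x) (dir_deriv radial x v) (dir_deriv radial x w)"

text \<open>
  Since \<open>radial\<close> is a surjective submersion that restricts to the identity of the sphere, a tensor
  field on the sphere is smooth iff its pullback is.
\<close>

definition smooth_tensor :: "'a::euclidean_space tensor02 \<Rightarrow> bool" where
  "smooth_tensor g \<longleftrightarrow> (\<forall>v w. smooth_on (- {0}) (\<lambda>x. radial_pullback g x v w))"

text \<open>
  Convergence in the C-infinity topology. The pullbacks are homogeneous under dilations, so uniform
  convergence of each iterated derivative on the sphere amounts to uniform convergence on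
  compact subsets of \<open>- {0}\<close>, that is, of all derivatives of the components in charts.
\<close>

definition smooth_converges :: "(nat \<Rightarrow> 'a::euclidean_space tensor02) \<Rightarrow> 'a tensor02 \<Rightarrow> bool" where
  "smooth_converges g h \<longleftrightarrow>
     (\<forall>v w ds. uniform_limit (sphere 0 1)
        (\<lambda>i. iter_dir_deriv ds (\<lambda>x. radial_pullback (g i) x v w))
        (iter_dir_deriv ds (\<lambda>x. radial_pullback h x v w)) sequentially)"

subsection \<open>Riemannian metrics and their curvature\<close>

definition riemannian_metric :: "'a::euclidean_space tensor02 \<Rightarrow> bool" where
  "riemannian_metric g \<longleftrightarrow>
     restrict_tensor g = g \<and> smooth_tensor g \<and>
     (\<forall>p\<in>sphere 0 1.
        (\<forall>u\<in>tangent p. \<forall>v\<in>tangent p. \<forall>w\<in>tangent p. \<forall>a b.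
           g p (a *\<^sub>R u + b *\<^sub>R v) w = a * g p u w + b * g p v w) \<and>
        (\<forall>v\<in>tangent p. \<forall>w\<in>tangent p. g p v w = g p w v) \<and>
        (\<forall>v\<in>tangent p. v \<noteq> 0 \<longrightarrow> g p v v > 0))"

definition round_metric :: "'a::euclidean_space tensor02" where
  "round_metric = restrict_tensor (\<lambda>p v w. v \<bullet> w)"

text \<open>
  Curvature at \<open>p\<close> is computed in the chart inverse to \<open>u \<mapsto> radial (p + u)\<close>, where \<open>u\<close> ranges over
  the tangent space at \<open>p\<close>. At the point \<open>x = p + u\<close> of the affine tangent hyperplane, the
  coordinate expression of \<open>g\<close> is \<open>radial_pullback g x\<close> on \<open>tangent p\<close>. The differential of the
  chart at \<open>u = 0\<close> is the identity of \<open>tangent p\<close>.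

  \<open>christoffel g p x v w\<close> is the covariant derivative at \<open>x\<close>, in the direction \<open>v\<close>, of the field
  with constant coordinate expression \<open>w\<close>; the formula is that of Koszul with the index
  raised implicitly.
\<close>

definition christoffel :: "'a::euclidean_space tensor02 \<Rightarrow> 'a \<Rightarrow> 'a \<Rightarrow> 'a \<Rightarrow> 'a \<Rightarrow> 'a" where
  "christoffel g p x v w =
     (THE y. y \<in> tangent p \<and>
        (\<forall>z\<in>tangent p. 2 * radial_pullback g x y z =
             dir_deriv (\<lambda>x. radial_pullback g x w z) x v
           + dir_deriv (\<lambda>x. radial_pullback g x v z) x w
           - dir_deriv (\<lambda>x. radial_pullback g x v w) x z))"

text \<open>Sign convention: \<open>R(u, v) = [\<nabla>\<^sub>u, \<nabla>\<^sub>v] - \<nabla>\<^bsub>[u,v]\<^esub>\<close>.\<close>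

definition riemann_curvature :: "'a::euclidean_space tensor02 \<Rightarrow> 'a \<Rightarrow> 'a \<Rightarrow> 'a \<Rightarrow> 'a \<Rightarrow> 'a" where
  "riemann_curvature g p u v w =
     dir_deriv (\<lambda>x. christoffel g p x v w) p u
   - dir_deriv (\<lambda>x. christoffel g p x u w) p v
   + christoffel g p p u (christoffel g p p v w)
   - christoffel g p p v (christoffel g p p u w)"

text \<open>
  \<open>Ric(v, w)\<close> is the trace of the endomorphism \<open>u \<mapsto> R(u, v) w\<close> of \<open>tangent p\<close>; precomposing with the
  projection turns it into an endomorphism of the ambient space with the same trace.
\<close>

definition ricci :: "'a::euclidean_space tensor02 \<Rightarrow> 'a tensor02" where
  "ricci g = restrict_tensor
     (\<lambda>p v w. \<Sum>b\<in>Basis. riemann_curvature g p (tangent_proj p b) v w \<bullet> b)"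

definition sectional_curvature :: "'a::euclidean_space tensor02 \<Rightarrow> 'a \<Rightarrow> 'a \<Rightarrow> 'a \<Rightarrow> real" where
  "sectional_curvature g p v w =
     g p (riemann_curvature g p v w w) v / (g p v v * g p w w - (g p v w)\<^sup>2)"

definition constant_curvature :: "'a::euclidean_space tensor02 \<Rightarrow> bool" where
  "constant_curvature g \<longleftrightarrow>
     (\<exists>\<kappa>. \<forall>p\<in>sphere 0 1. \<forall>v\<in>tangent p. \<forall>w\<in>tangent p.
        v \<noteq> w \<and> independent {v, w} \<longrightarrow> sectional_curvature g p v w = \<kappa>)"

definition ricci_iteration_from ::
  "'a::euclidean_space tensor02 \<Rightarrow> (nat \<Rightarrow> 'a tensor02) \<Rightarrow> bool" where
  "ricci_iteration_from h g \<longleftrightarrow>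
     (\<forall>i\<ge>1. riemannian_metric (g i)) \<and> ricci (g 1) = h \<and> (\<forall>i\<ge>1. ricci (g (i + 1)) = g i)"

subsection \<open>The space of homogeneous metrics\<close>

definition Sp_invariant :: "(quat ^ 'm::finite) tensor02 \<Rightarrow> bool" where
  "Sp_invariant g \<longleftrightarrow>
     (\<forall>A\<in>Sp. \<forall>p\<in>sphere 0 1. \<forall>v\<in>tangent p. \<forall>w\<in>tangent p.
        g (qmat_vec A p) (qmat_vec A v) (qmat_vec A w) = g p v w)"

definition homogeneous_metrics :: "(quat ^ 'm::finite) tensor02 set" where
  "homogeneous_metrics = {g. riemannian_metric g \<and> Sp_invariant g}"

text \<open>
  The topology induced by \<open>g \<mapsto> g p\<close>, for a base point \<open>p\<close> of the sphere. The product topology of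
  \<open>'a \<Rightarrow> 'a \<Rightarrow> real\<close> induces on the finite-dimensional space of symmetric bilinear forms on
  \<open>tangent p\<close> (extended by zero) its unique Hausdorff vector space topology.
\<close>

definition homogeneous_metric_topology ::
  "quat ^ 'm \<Rightarrow> (quat ^ 'm::finite) tensor02 topology" where
  "homogeneous_metric_topology p = pullback_topology homogeneous_metrics (\<lambda>g. g p) euclidean"

end

theory Submission
  imports Defs
begin

text \<open>
  The isotropy group splits the tangent space at \<open>p\<close> into the vertical space \<open>p\<cdot>Im H\<close>, on which it
  acts trivially, and its orthogonal complement, on whose spheres it is transitive. So, after
  diagonalizing the vertical part by a choice of orthonormal imaginary units, every invariant
  metric is \<open>s (\<langle>v, w\<rangle> + \<Sum>\<^sub>a k\<^sub>a \<eta>\<^sub>a(v) \<eta>\<^sub>a(w))\<close> with \<open>\<eta>\<^sub>a(v) = \<langle>v, J\<^sub>a p\<rangle>\<close>. The Ricci tensor has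
  again this form, with the same \<open>J\<^sub>a\<close> and independently of \<open>s\<close>, so it induces a map \<open>k \<mapsto> F(k)\<close> on
  the shapes. Its derivative at the round metric \<open>k = 0\<close> is the scalar \<open>(4n+3)/(2n+1) > 1\<close>. Hence
  Brouwer's theorem provides each small \<open>y\<close> with a preimage closer to \<open>0\<close> by a fixed factor;
  iterating gives \<open>F(z\<^sub>i\<^sub>+\<^sub>1) = z\<^sub>i \<rightarrow> 0\<close>, and giving \<open>z\<^sub>i\<close> the scale that the Ricci tensor of
  shape \<open>z\<^sub>i\<^sub>+\<^sub>1\<close> dictates yields the iteration.
\<close>

subsection \<open>Directional derivatives of rational functions\<close>

text \<open>Curvature is defined in a chart at each point, with the Christoffel symbols given by a
  definite description. The proof therefore guesses a closed formula for the symbols on the affine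
  tangent hyperplane, verifies Koszul's identity for it by polynomial algebra, differentiates it
  along lines in the hyperplane and takes traces. Everything is written in inner products with
  \<open>x\<close> and the \<open>J\<close> images of vectors, so that only the quaternion relations
  enter. The expansion factor arises as follows: with N = 4n+4, the vertical minus the horizontal
  Ricci value is 2 (N - 1) k_a plus terms of second order, while the horizontal value at k = 0 is N
  - 2; different k_a interact only to second order. Brouwer's theorem serves in place of an inverse
  function theorem because it asks only for continuity near 0 and the derivative at 0 itself. The
  diagonalizing units depend on the metric. The neighborhood is therefore cut out by evaluations at
  fixed vectors that control all vertical values at once.\<close>

lemma dir_deriv_eq:
  assumes "(f has_derivative f') (at x)"
  shows "dir_deriv f x v = f' v"
proof -
  have "((\<lambda>t. x + t *\<^sub>R v) has_derivative (\<lambda>t. t *\<^sub>R v)) (at 0)"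
    by (auto intro!: derivative_eq_intros)
  moreover have "(f has_derivative f') (at (x + 0 *\<^sub>R v))" using assms by simp
  ultimately have "((\<lambda>t. f (x + t *\<^sub>R v)) has_derivative (\<lambda>t. f' (t *\<^sub>R v))) (at 0)"
    by (rule has_derivative_compose)
  then have "((\<lambda>t. f (x + t *\<^sub>R v)) has_vector_derivative f' v) (at 0)"
    using linear_scale[OF has_derivative_linear[OF assms]] by (simp add: has_vector_derivative_def)
  then show ?thesis unfolding dir_deriv_def by (rule vector_derivative_at)
qed

text \<open>Only the line through \<open>x\<close> matters. The closed formula for the Christoffel
  symbols is established on a hyperplane, which is not open but contains the lines along which it is
  differentiated.\<close>

lemma dir_deriv_cong_line:
  assumes "\<And>t. f (x + t *\<^sub>R v) = g (x + t *\<^sub>R v)"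
  shows "dir_deriv f x v = dir_deriv g x v"
  using assms by (simp add: dir_deriv_def)

lemma dir_deriv_radial:
  fixes x :: "'a::euclidean_space"
  assumes "x \<noteq> 0"
  shows "dir_deriv radial x v = (v - ((v \<bullet> x) / (x \<bullet> x)) *\<^sub>R x) /\<^sub>R norm x"
proof -
  have "(radial has_derivative (\<lambda>v. (v - ((v \<bullet> x) / (x \<bullet> x)) *\<^sub>R x) /\<^sub>R norm x)) (at x)"
    unfolding radial_def using assms
    by (auto intro!: derivative_eq_intros has_derivative_norm[OF assms]
        simp: fun_eq_iff scaleR_right_diff_distrib sgn_div_norm dot_square_norm inner_commute
          power2_eq_square divide_simps)
  then show ?thesis by (rule dir_deriv_eq)
qed

text \<open>
  An algebra of functions containing the components of the metrics below and closed under
  directional derivatives.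
\<close>

inductive rat_fun :: "('a::euclidean_space \<Rightarrow> real) \<Rightarrow> bool" where
  const: "rat_fun (\<lambda>x. c)"
| inner: "rat_fun (\<lambda>x. x \<bullet> a)"
| inv: "rat_fun (\<lambda>x. inverse (x \<bullet> x))"
| add: "rat_fun f \<Longrightarrow> rat_fun g \<Longrightarrow> rat_fun (\<lambda>x. f x + g x)"
| mult: "rat_fun f \<Longrightarrow> rat_fun g \<Longrightarrow> rat_fun (\<lambda>x. f x * g x)"

lemma rat_fun_derivative:
  assumes "rat_fun f"
  shows "\<exists>D. (\<forall>x. x \<noteq> 0 \<longrightarrow> (f has_derivative D x) (at x)) \<and> (\<forall>d. rat_fun (\<lambda>x. D x d))"
  using assms
proof induction
  case (const c)
  show ?case by (rule exI[of _ "\<lambda>x d. 0"]) (simp add: rat_fun.const)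
next
  case (inner a)
  have "((\<lambda>x. x \<bullet> a) has_derivative (\<lambda>d. d \<bullet> a)) (at x)" for x
    by (auto intro!: derivative_eq_intros)
  then show ?case by (intro exI[of _ "\<lambda>x d. d \<bullet> a"]) (simp add: rat_fun.const)
next
  case inv
  define D where "D x d = (-2) * (x \<bullet> d * (inverse (x \<bullet> x) * inverse (x \<bullet> x)))" for x d :: 'a
  have "((\<lambda>x. inverse (x \<bullet> x)) has_derivative D x) (at x)" if "x \<noteq> 0" for x
    unfolding D_def using that by (auto intro!: derivative_eq_intros simp: fun_eq_iff inner_commute)
  moreover have "rat_fun (\<lambda>x. D x d)" for d
    unfolding D_def by (intro rat_fun.const rat_fun.inner rat_fun.inv rat_fun.mult)
  ultimately show ?case by blast
next
  case (add f g)
  from add.IH obtain D E where D: "\<And>x. x \<noteq> 0 \<Longrightarrow> (f has_derivative D x) (at x)" "\<And>d. rat_fun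
      (\<lambda>x. D x d)"
    and E: "\<And>x. x \<noteq> 0 \<Longrightarrow> (g has_derivative E x) (at x)" "\<And>d. rat_fun (\<lambda>x. E x d)"
    by auto
  show ?case
    by (intro exI[of _ "\<lambda>x d. D x d + E x d"] conjI allI impI has_derivative_add D E rat_fun.add)
next
  case (mult f g)
  from mult.IH obtain D E where D: "\<And>x. x \<noteq> 0 \<Longrightarrow> (f has_derivative D x) (at x)" "\<And>d. rat_fun
      (\<lambda>x. D x d)"
    and E: "\<And>x. x \<noteq> 0 \<Longrightarrow> (g has_derivative E x) (at x)" "\<And>d. rat_fun (\<lambda>x. E x d)"
    by auto
  show ?case
    by (intro exI[of _ "\<lambda>x d. f x * E x d + D x d * g x"] conjI allI impI has_derivative_mult D E
        rat_fun.add rat_fun.mult mult.hyps)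
qed

text \<open>Nothing is known about \<open>radial_pullback\<close> and its iterated
  \<open>dir_deriv\<close> at the origin, so membership in the algebra is asked for only away from
  it.\<close>

definition rat_off_0 :: "('a::euclidean_space \<Rightarrow> real) \<Rightarrow> bool" where
  "rat_off_0 f \<longleftrightarrow> (\<exists>g. rat_fun g \<and> (\<forall>x. x \<noteq> 0 \<longrightarrow> f x = g x))"

lemma rat_fun_imp_rat_off_0: "rat_fun f \<Longrightarrow> rat_off_0 f"
  by (auto simp: rat_off_0_def)

lemma rat_off_0_derivative:
  assumes "rat_off_0 f"
  shows "\<exists>D. (\<forall>x. x \<noteq> 0 \<longrightarrow> (f has_derivative D x) (at x)) \<and> (\<forall>d. rat_fun (\<lambda>x. D x d))"
proof -
  obtain g where g: "rat_fun g" "\<And>x. x \<noteq> 0 \<Longrightarrow> f x = g x" using assms by (auto simp: rat_off_0_def)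
  obtain D where D: "\<And>x. x \<noteq> 0 \<Longrightarrow> (g has_derivative D x) (at x)" "\<And>d. rat_fun (\<lambda>x. D x d)"
    using rat_fun_derivative[OF g(1)] by blast
  have "(f has_derivative D x) (at x)" if "x \<noteq> 0" for x
    by (rule has_derivative_transform_within_open[OF D(1)[OF that], of "- {0}"])
        (use g(2) that in auto)
  then show ?thesis using D(2) by auto
qed

lemma rat_off_0_iter_dir_deriv: "rat_off_0 f \<Longrightarrow> rat_off_0 (iter_dir_deriv ds f)"
proof (induction ds)
  case (Cons d ds)
  then have "rat_off_0 (iter_dir_deriv ds f)" by simp
  from rat_off_0_derivative[OF this]
  obtain D where D: "\<And>x. x \<noteq> 0 \<Longrightarrow> (iter_dir_deriv ds f has_derivative D x) (at x)"
      "\<And>d. rat_fun (\<lambda>x. D x d)"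
    by auto
  have "\<forall>x. x \<noteq> 0 \<longrightarrow> iter_dir_deriv (d # ds) f x = D x d"
    using dir_deriv_eq[OF D(1)] by simp
  then show ?case unfolding rat_off_0_def using D(2) by auto
qed simp

lemma rat_off_0_differentiable_on:
  assumes "rat_off_0 f"
  shows "f differentiable_on - {0}"
proof -
  obtain D where "\<And>x. x \<noteq> 0 \<Longrightarrow> (f has_derivative D x) (at x)"
    using rat_off_0_derivative[OF assms] by auto
  then show ?thesis
    by (intro differentiable_at_imp_differentiable_on differentiableI) auto
qed

lemma rat_off_0_smooth_on: "rat_off_0 f \<Longrightarrow> smooth_on (- {0}) f"
  by (simp add: smooth_on_def rat_off_0_differentiable_on rat_off_0_iter_dir_deriv)

section \<open>Iterated derivatives of linear combinations and their uniform limits\<close>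

lemma iter_dir_deriv_lincomb:
  fixes f g h :: "'a::euclidean_space \<Rightarrow> real"
  assumes "rat_off_0 f" "rat_off_0 g" "\<And>x. x \<noteq> 0 \<Longrightarrow> h x = f x + b * g x" "x \<noteq> 0"
  shows "iter_dir_deriv ds h x = iter_dir_deriv ds f x + b * iter_dir_deriv ds g x"
  using assms(4)
proof (induction ds arbitrary: x)
  case (Cons d ds)
  let ?F = "iter_dir_deriv ds f" and ?G = "iter_dir_deriv ds g" and ?H = "iter_dir_deriv ds h"
  obtain D where D: "\<And>x. x \<noteq> 0 \<Longrightarrow> (?F has_derivative D x) (at x)"
    using rat_off_0_derivative[OF rat_off_0_iter_dir_deriv[OF assms(1), where ds=ds]] by auto
  obtain E where E: "\<And>x. x \<noteq> 0 \<Longrightarrow> (?G has_derivative E x) (at x)"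
    using rat_off_0_derivative[OF rat_off_0_iter_dir_deriv[OF assms(2), where ds=ds]] by auto
  have "((\<lambda>x. ?F x + b * ?G x) has_derivative (\<lambda>d. D x d + b * E x d)) (at x)"
    using D[OF Cons.prems] E[OF Cons.prems] by (auto intro!: derivative_eq_intros)
  then have "(?H has_derivative (\<lambda>d. D x d + b * E x d)) (at x)"
    by (rule has_derivative_transform_within_open[of _ _ _ _ "- {0}"]) (use Cons in auto)
  then show ?case using D[OF Cons.prems] E[OF Cons.prems] by (simp add: dir_deriv_eq)
qed (use assms(3) in simp)

text \<open>As \<open>g\<close> is independent of \<open>i\<close>, its iterated derivative is one
  continuous function, bounded on the compact sphere, so convergence of the numbers
  \<open>b i\<close> suffices. The form with a single new summand lets a metric be built up term by
  term.\<close>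

lemma uniform_limit_iter_dir_deriv_lincomb:
  fixes f h :: "nat \<Rightarrow> 'a::euclidean_space \<Rightarrow> real" and b :: "nat \<Rightarrow> real"
  assumes "\<And>i. rat_off_0 (f i)" "rat_off_0 f'" "rat_off_0 g" "b \<longlonglongrightarrow> b'"
    and lim: "uniform_limit (sphere 0 1) (\<lambda>i. iter_dir_deriv ds (f i)) (iter_dir_deriv ds f')
        sequentially"
    and h: "\<And>i x. x \<noteq> 0 \<Longrightarrow> h i x = f i x + b i * g x" "\<And>x. x \<noteq> 0 \<Longrightarrow> h' x = f' x + b' * g x"
  shows "uniform_limit (sphere 0 1) (\<lambda>i. iter_dir_deriv ds (h i)) (iter_dir_deriv ds h')
      sequentially"
proof -
  let ?G = "iter_dir_deriv ds g"
  have "continuous_on (- {0}) ?G"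
    by (intro differentiable_imp_continuous_on rat_off_0_differentiable_on
        rat_off_0_iter_dir_deriv assms(3))
  then have "continuous_on (sphere 0 1) ?G" by (rule continuous_on_subset) auto
  then have bd: "bounded (?G ` sphere 0 1)"
    by (intro compact_imp_bounded compact_continuous_image compact_sphere)
  have "uniform_limit (sphere 0 1) (\<lambda>i x. b i) (\<lambda>x. b') sequentially"
    using assms(4) by (auto simp: uniform_limit_iff tendsto_iff elim: eventually_mono)
  then have "uniform_limit (sphere 0 1) (\<lambda>i x. b i * ?G x) (\<lambda>x. b' * ?G x) sequentially"
    by (intro uniform_lim_mult uniform_limit_const bd) (auto simp: bounded_iff)
  from uniform_limit_add[OF lim this]
  have lim2: "uniform_limit (sphere 0 1) (\<lambda>i x. iter_dir_deriv ds (f i) x + b i * ?G x)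
    (\<lambda>x. iter_dir_deriv ds f' x + b' * ?G x) sequentially" .
  have eq: "iter_dir_deriv ds (h i) x = iter_dir_deriv ds (f i) x + b i * ?G x"
      "iter_dir_deriv ds h' x = iter_dir_deriv ds f' x + b' * ?G x" if "x \<in> sphere 0 1" for i x
  proof -
    have "x \<noteq> 0" using that by auto
    then show "iter_dir_deriv ds (h i) x = iter_dir_deriv ds (f i) x + b i * ?G x"
      by (intro iter_dir_deriv_lincomb assms(1,3) h(1))
    show "iter_dir_deriv ds h' x = iter_dir_deriv ds f' x + b' * ?G x" using \<open>x \<noteq> 0\<close>
      by (intro iter_dir_deriv_lincomb assms(2,3) h(2))
  qed
  show ?thesis
    by (rule uniform_limit_cong'[THEN iffD1, OF _ _ lim2]) (simp_all only: eq)
qed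

subsection \<open>Metrics defined by a quaternionic triple\<close>

text \<open>The triple is abstract because the imaginary units are chosen afresh for each initial
  metric; the whole curvature computation uses just these relations and the real inner
  product.\<close>

locale quat_triple =
  fixes J1 J2 J3 :: "'a::euclidean_space \<Rightarrow> 'a"
  assumes lin1: "linear J1" and lin2: "linear J2"
    and skew1: "J1 x \<bullet> y = - (x \<bullet> J1 y)" and skew2: "J2 x \<bullet> y = - (x \<bullet> J2 y)"
    and J11: "J1 (J1 x) = - x" and J22: "J2 (J2 x) = - x"
    and J12: "J1 (J2 x) = J3 x" and J21: "J2 (J1 x) = - J3 x"
begin

lemmas J1_lin = linear_add[OF lin1] linear_diff[OF lin1] linear_scale[OF lin1] linear_neg[OF lin1]
  linear_0[OF lin1]
lemmas J2_lin = linear_add[OF lin2] linear_diff[OF lin2] linear_scale[OF lin2] linear_neg[OF lin2]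
  linear_0[OF lin2]

lemma lin3: "linear J3"
  using linear_compose[OF lin2 lin1] by (simp add: o_def J12)

lemmas J3_lin = linear_add[OF lin3] linear_diff[OF lin3] linear_scale[OF lin3] linear_neg[OF lin3]
  linear_0[OF lin3]

lemmas J_lin = J1_lin J2_lin J3_lin

lemma J3_eq: "J3 x = - J2 (J1 x)" by (simp add: J21)
lemma J13: "J1 (J3 x) = - J2 x" using J11[of "J2 x"] by (simp only: J12)
lemma J31: "J3 (J1 x) = J2 x" by (simp only: J3_eq J11 J_lin minus_minus)
lemma J23: "J2 (J3 x) = J1 x" by (simp only: J3_eq J22 J_lin minus_minus)
lemma J32: "J3 (J2 x) = - J1 x" by (simp only: J12[symmetric] J22 J_lin)
lemma J33: "J3 (J3 x) = - x" by (simp only: J12[of "J3 x", symmetric] J23 J11)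

lemma skew3: "J3 x \<bullet> y = - (x \<bullet> J3 y)"
  using J12[of x] J21[of y] skew1[of "J2 x" y] skew2[of x "J1 y"] by simp

lemmas J_mult = J11 J22 J33 J12 J21 J13 J31 J23 J32
lemmas J_skew = skew1 skew2 skew3

lemma J_self [simp]: "x \<bullet> J1 x = 0" "x \<bullet> J2 x = 0" "x \<bullet> J3 x = 0"
  using J_skew[of x x] inner_commute[of x "J1 x"] inner_commute[of x "J2 x"]
      inner_commute[of x "J3 x"]
  by linarith+

text \<open>
  Bessel's inequality for the orthonormal vectors \<open>J\<^sub>1 p\<close>, \<open>J\<^sub>2 p\<close>, \<open>J\<^sub>3 p\<close> gives the positivity.
\<close>

lemma form_pos:
  assumes "p \<bullet> p = 1" "y \<noteq> 0" "k1 > -1" "k2 > -1" "k3 > -1"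
  shows "y \<bullet> y + k1 * (y \<bullet> J1 p)\<^sup>2 + k2 * (y \<bullet> J2 p)\<^sup>2 + k3 * (y \<bullet> J3 p)\<^sup>2 > 0"
proof -
  let ?h = "y - (y \<bullet> J1 p) *\<^sub>R J1 p - (y \<bullet> J2 p) *\<^sub>R J2 p - (y \<bullet> J3 p) *\<^sub>R J3 p"
  have h: "?h \<bullet> ?h = y \<bullet> y - (y \<bullet> J1 p)\<^sup>2 - (y \<bullet> J2 p)\<^sup>2 - (y \<bullet> J3 p)\<^sup>2"
    using assms(1) inner_commute[of "J1 p" y] inner_commute[of "J2 p" y] inner_commute[of "J3 p" y]
    by (simp add: inner_diff_left inner_diff_right J_skew J_mult J_lin power2_eq_square)
  have "y \<bullet> y > 0" using assms by simp
  moreover have "?h \<bullet> ?h \<ge> 0" by simp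
  moreover have "(1 + k1) * (y \<bullet> J1 p)\<^sup>2 \<ge> 0" "(1 + k2) * (y \<bullet> J2 p)\<^sup>2 \<ge> 0" "(1 + k3) *
      (y \<bullet> J3 p)\<^sup>2 \<ge> 0"
    using assms by simp_all
  \<comment> \<open>The form is |h|^2 plus the three terms (1 + k_a) <y, J_a p>^2, \<open>h\<close>
    being the horizontal part. If these three vanish, so do the squares in them, and |h|^2 = |y|^2 >
    0 is left.\<close>
  moreover have "(y \<bullet> J1 p)\<^sup>2 = 0" if "(1 + k1) * (y \<bullet> J1 p)\<^sup>2 = 0" using assms that by simp
  moreover have "(y \<bullet> J2 p)\<^sup>2 = 0" if "(1 + k2) * (y \<bullet> J2 p)\<^sup>2 = 0" using assms that by simp
  moreover have "(y \<bullet> J3 p)\<^sup>2 = 0" if "(1 + k3) * (y \<bullet> J3 p)\<^sup>2 = 0" using assms that by simp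
  ultimately show ?thesis using h by (simp only: distrib_right) linarith
qed

text \<open>
  The eigenvalues of this metric are \<open>s\<close> on horizontal and \<open>s (1 + k\<^sub>a)\<close> on vertical vectors; its
  Levi-Civita connection does not depend on \<open>s\<close>.
\<close>

definition metric :: "real \<Rightarrow> real \<Rightarrow> real \<Rightarrow> real \<Rightarrow> 'a tensor02" where
  "metric s k1 k2 k3 = restrict_tensor (\<lambda>p v w. s * (v \<bullet> w + k1 * (v \<bullet> J1 p) * (w \<bullet> J1 p)
     + k2 * (v \<bullet> J2 p) * (w \<bullet> J2 p) + k3 * (v \<bullet> J3 p) * (w \<bullet> J3 p)))"

section \<open>Pullbacks of the metrics along \<open>radial\<close>\<close>

definition round_part :: "'a \<Rightarrow> 'a \<Rightarrow> 'a \<Rightarrow> real" where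
  "round_part x v w = inverse (x \<bullet> x) * (v \<bullet> w) - (inverse (x \<bullet> x))\<^sup>2 * (v \<bullet> x) * (w \<bullet> x)"

text \<open>The one-form v -> <v, J p> on the sphere pulls back to <v, J x> / |x|^2; this is its
  tensor square. Like \<open>round_part\<close>, the pullback of the round metric, it is polynomial
  in \<open>x\<close> and 1 / |x|^2 for linear \<open>J\<close>.\<close>

definition eta_part :: "('a \<Rightarrow> 'a) \<Rightarrow> 'a \<Rightarrow> 'a \<Rightarrow> 'a \<Rightarrow> real" where
  "eta_part J x v w = (inverse (x \<bullet> x))\<^sup>2 * (v \<bullet> J x) * (w \<bullet> J x)"

definition pull_metric :: "real \<Rightarrow> real \<Rightarrow> real \<Rightarrow> real \<Rightarrow> 'a \<Rightarrow> 'a \<Rightarrow> 'a \<Rightarrow> real" where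
  "pull_metric s k1 k2 k3 x v w = s * (round_part x v w + k1 * eta_part J1 x v w + k2 * eta_part
      J2 x v w
     + k3 * eta_part J3 x v w)"

lemma radial_tangent:
  assumes "x \<noteq> 0"
  shows "radial x \<in> sphere 0 1" "radial x \<bullet> radial x = 1" "dir_deriv radial x v \<in> tangent
      (radial x)"
  using assms
  by (auto simp: radial_def dir_deriv_radial tangent_def inner_diff_left inner_diff_right
      inner_commute field_simps
      dot_square_norm power2_eq_square)

lemma radial_pullback_metric:
  assumes "x \<noteq> 0"
  shows "radial_pullback (metric s k1 k2 k3) x v w = pull_metric s k1 k2 k3 x v w"
proof -
  have n: "inverse (norm x) * inverse (norm x) = inverse (x \<bullet> x)"
    by (simp add: dot_square_norm power2_eq_square)
  have eta: "dir_deriv radial x v \<bullet> J1 (radial x) = inverse (x \<bullet> x) * (v \<bullet> J1 x)"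
      "dir_deriv radial x v \<bullet> J2 (radial x) = inverse (x \<bullet> x) * (v \<bullet> J2 x)"
      "dir_deriv radial x v \<bullet> J3 (radial x) = inverse (x \<bullet> x) * (v \<bullet> J3 x)" for v
    by (simp_all add: dir_deriv_radial radial_def[of x] assms inner_diff_left J_lin n[symmetric])
  have "dir_deriv radial x v \<bullet> dir_deriv radial x w = round_part x v w"
    using assms
    by (simp add: dir_deriv_radial round_part_def inner_diff_left inner_diff_right
        dot_square_norm[symmetric] n[symmetric] inner_commute)
      (simp add: dot_square_norm field_simps power2_eq_square)
  then show ?thesis
    using assms radial_tangent[OF assms]
    by (simp add: radial_pullback_def metric_def restrict_tensor_def pull_metric_def eta_part_def
      eta power2_eq_square)
qed

lemma rat_fun_minus: "rat_fun f \<Longrightarrow> rat_fun g \<Longrightarrow> rat_fun (\<lambda>x. f x - g x)"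
  using rat_fun.add[of f "\<lambda>x. (-1) * g x"] rat_fun.mult[OF rat_fun.const[of "-1"], of g] by simp

lemma rat_round_part: "rat_fun (\<lambda>x. round_part x v w)"
proof -
  have "round_part x v w = inverse (x \<bullet> x) * (v \<bullet> w) - inverse (x \<bullet> x) * inverse (x \<bullet> x) * (x \<bullet> v)
      * (x \<bullet> w)" for x
    by (simp add: round_part_def power2_eq_square inner_commute)
  note eq = this
  show ?thesis unfolding eq by (intro rat_fun.const rat_fun.inner rat_fun.inv rat_fun.mult
      rat_fun_minus)
qed

lemma rat_eta_part:
  assumes "J \<in> {J1, J2, J3}"
  shows "rat_fun (\<lambda>x. eta_part J x v w)"
proof -
  have J: "v \<bullet> J x = (-1) * (x \<bullet> J v)" for v x
    using assms J_skew[of x v] inner_commute[of v "J x"] by auto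
  show ?thesis
    unfolding eta_part_def power2_eq_square J[of v] J[of w]
    by (intro rat_fun.const rat_fun.inner rat_fun.inv rat_fun.mult)
qed

lemma rat_pull_metric: "rat_fun (\<lambda>x. pull_metric s k1 k2 k3 x v w)"
  unfolding pull_metric_def by (intro rat_fun.const rat_fun.mult rat_fun.add rat_round_part
      rat_eta_part) auto

lemma smooth_metric: "smooth_tensor (metric s k1 k2 k3)"
  unfolding smooth_tensor_def
  by (intro allI rat_off_0_smooth_on) (auto simp: rat_off_0_def radial_pullback_metric intro!: exI
      rat_pull_metric)

lemma riemannian_metric_metric:
  assumes "s > 0" "k1 > -1" "k2 > -1" "k3 > -1"
  shows "riemannian_metric (metric s k1 k2 k3)"
proof -
  have "metric s k1 k2 k3 p v v > 0" if "p \<in> sphere 0 1" "v \<in> tangent p" "v \<noteq> 0" for p v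
  proof -
    have "p \<bullet> p = 1" using that(1) by (simp add: dot_square_norm)
    from form_pos[OF this that(3) assms(2-4)] show ?thesis
      using that assms(1) by (simp add: metric_def restrict_tensor_def power2_eq_square mult.assoc)
  qed
  moreover have "metric s k1 k2 k3 p v w = metric s k1 k2 k3 p w v" for p v w
    by (simp add: metric_def restrict_tensor_def inner_commute mult.assoc mult.left_commute
        mult.commute)
  moreover have "metric s k1 k2 k3 p (a *\<^sub>R u + b *\<^sub>R v) w
      = a * metric s k1 k2 k3 p u w + b * metric s k1 k2 k3 p v w"
    if "p \<in> sphere 0 1" "u \<in> tangent p" "v \<in> tangent p" "w \<in> tangent p" for p u v w a b
  proof -
    have "a *\<^sub>R u + b *\<^sub>R v \<in> tangent p" using that by (simp add: tangent_def inner_add_left)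
    then show ?thesis using that
      by (simp add: metric_def restrict_tensor_def inner_add_left algebra_simps)
  qed
  moreover have "restrict_tensor (metric s k1 k2 k3) = metric s k1 k2 k3"
    by (auto simp: metric_def restrict_tensor_def fun_eq_iff)
  ultimately show ?thesis unfolding riemannian_metric_def using smooth_metric by blast
qed

text \<open>The pulled-back form is degenerate in the direction \<open>x\<close>, but x . p = 1
  keeps \<open>x\<close> out of \<open>tangent p\<close>, so the derivative of \<open>radial\<close>
  is injective there.\<close>

lemma pull_metric_pos:
  assumes "s > 0" "k1 > -1" "k2 > -1" "k3 > -1" "x \<bullet> p = 1" "z \<in> tangent p" "z \<noteq> 0"
  shows "pull_metric s k1 k2 k3 x z z > 0"
proof -
  have x: "x \<noteq> 0" using assms(5) by auto
  let ?y = "dir_deriv radial x z"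
  have "z - ((z \<bullet> x) / (x \<bullet> x)) *\<^sub>R x \<noteq> 0"
  proof
    assume eq: "z - ((z \<bullet> x) / (x \<bullet> x)) *\<^sub>R x = 0"
    then have "(z - ((z \<bullet> x) / (x \<bullet> x)) *\<^sub>R x) \<bullet> p = 0" by simp
    then have "(z \<bullet> x) / (x \<bullet> x) = 0" using assms(5,6) by (simp add: tangent_def inner_diff_left)
    then show False using eq assms(7) by (simp only: scaleR_zero_left diff_zero)
  qed
  then have "?y \<noteq> 0" using x by (simp add: dir_deriv_radial)
  moreover have "riemannian_metric (metric s k1 k2 k3)" by (rule riemannian_metric_metric) fact+
  ultimately have "metric s k1 k2 k3 (radial x) ?y ?y > 0"
    using radial_tangent[OF x] unfolding riemannian_metric_def by blast
  then show ?thesis using radial_pullback_metric[OF x] by (simp add: radial_pullback_def)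
qed

subsection \<open>Christoffel symbols\<close>

lemma round_part_linear:
  "round_part x (a + b) w = round_part x a w + round_part x b w"
  "round_part x (a - b) w = round_part x a w - round_part x b w"
  "round_part x (c *\<^sub>R a) w = c * round_part x a w"
  by (simp_all add: round_part_def inner_add_left inner_diff_left algebra_simps)

lemma eta_part_linear:
  "eta_part J x (a + b) w = eta_part J x a w + eta_part J x b w"
  "eta_part J x (a - b) w = eta_part J x a w - eta_part J x b w"
  "eta_part J x (c *\<^sub>R a) w = c * eta_part J x a w"
  by (simp_all add: eta_part_def inner_add_left inner_diff_left algebra_simps)

lemma pull_metric_linear:
  "pull_metric s k1 k2 k3 x (a + b) w = pull_metric s k1 k2 k3 x a w + pull_metric s k1 k2 k3 x b w"
  "pull_metric s k1 k2 k3 x (a - b) w = pull_metric s k1 k2 k3 x a w - pull_metric s k1 k2 k3 x b w"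
  "pull_metric s k1 k2 k3 x (c *\<^sub>R a) w = c * pull_metric s k1 k2 k3 x a w"
  by (simp_all add: pull_metric_def round_part_linear eta_part_linear algebra_simps)

definition d_round_part :: "'a \<Rightarrow> 'a \<Rightarrow> 'a \<Rightarrow> 'a \<Rightarrow> real" where
  "d_round_part x u v w = (let q = inverse (x \<bullet> x) in
     - 2 * q\<^sup>2 * (u \<bullet> x) * (v \<bullet> w) - q\<^sup>2 * ((v \<bullet> u) * (w \<bullet> x) + (v \<bullet> x) * (w \<bullet> u))
     + 4 * q^3 * (u \<bullet> x) * (v \<bullet> x) * (w \<bullet> x))"

definition d_eta_part :: "('a \<Rightarrow> 'a) \<Rightarrow> 'a \<Rightarrow> 'a \<Rightarrow> 'a \<Rightarrow> 'a \<Rightarrow> real" where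
  "d_eta_part J x u v w = (let q = inverse (x \<bullet> x) in
     q\<^sup>2 * ((v \<bullet> J u) * (w \<bullet> J x) + (v \<bullet> J x) * (w \<bullet> J u))
     - 4 * q^3 * (u \<bullet> x) * (v \<bullet> J x) * (w \<bullet> J x))"

definition d_pull_metric :: "real \<Rightarrow> real \<Rightarrow> real \<Rightarrow> real \<Rightarrow> 'a \<Rightarrow> 'a \<Rightarrow> 'a \<Rightarrow> 'a \<Rightarrow> real" where
  "d_pull_metric s k1 k2 k3 x u v w = s * (d_round_part x u v w + k1 * d_eta_part J1 x u v w
     + k2 * d_eta_part J2 x u v w + k3 * d_eta_part J3 x u v w)"

lemma has_derivative_round_part:
  assumes "x \<noteq> 0"
  shows "((\<lambda>x. round_part x v w) has_derivative (\<lambda>u. d_round_part x u v w)) (at x)"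
proof -
  have q: "((\<lambda>x. inverse (x \<bullet> x)) has_derivative (\<lambda>u. - 2 * (inverse (x \<bullet> x))\<^sup>2 * (u \<bullet> x))) (at x)"
    using assms by (auto intro!: derivative_eq_intros simp: fun_eq_iff inner_commute
        power2_eq_square)
  show ?thesis using assms
    unfolding round_part_def d_round_part_def Let_def
    by (auto intro!: derivative_eq_intros q simp: fun_eq_iff inner_commute algebra_simps
        power2_eq_square power3_eq_cube)
qed

lemma has_derivative_eta_part:
  assumes "x \<noteq> 0" "linear J"
  shows "((\<lambda>x. eta_part J x v w) has_derivative (\<lambda>u. d_eta_part J x u v w)) (at x)"
proof -
  have q: "((\<lambda>x. inverse (x \<bullet> x)) has_derivative (\<lambda>u. - 2 * (inverse (x \<bullet> x))\<^sup>2 * (u \<bullet> x))) (at x)"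
    using assms(1) by (auto intro!: derivative_eq_intros simp: fun_eq_iff inner_commute
        power2_eq_square)
  have J: "(J has_derivative J) (at x)"
    using assms(2) by (simp add: linear_conv_bounded_linear bounded_linear_imp_has_derivative)
  show ?thesis using assms(1)
    unfolding eta_part_def d_eta_part_def Let_def
    by (auto intro!: derivative_eq_intros q J simp: fun_eq_iff inner_commute algebra_simps
        power2_eq_square power3_eq_cube)
qed

lemma has_derivative_pull_metric:
  assumes "x \<noteq> 0"
  shows "((\<lambda>x. pull_metric s k1 k2 k3 x v w) has_derivative
      (\<lambda>u. d_pull_metric s k1 k2 k3 x u v w)) (at x)"
  unfolding pull_metric_def d_pull_metric_def
  by (intro has_derivative_mult_right has_derivative_add has_derivative_round_part
      has_derivative_eta_part assms lin1 lin2 lin3)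

lemma dir_deriv_metric:
  assumes "x \<noteq> 0"
  shows "dir_deriv (\<lambda>x. radial_pullback (metric s k1 k2 k3) x v w) x u = d_pull_metric s k1 k2 k3
      x u v w"
proof (rule dir_deriv_eq, rule has_derivative_transform_within_open[OF
    has_derivative_pull_metric[OF assms]])
  show "open (- {0} :: 'a set)" "x \<in> - {0}" using assms by auto
qed (simp add: radial_pullback_metric)

text \<open>The terms \<open>chr_sym\<close> raise the index with the round metric. On the pair J1
  x, J2 x they produce, up to powers of |x|, the multiple k1 - k2 of J3 x, whereas the metric, which
  stretches that direction by 1 + k3, requires (k1 - k2) / (1 + k3). This coefficient is the
  difference.\<close>

definition mix_coeff :: "real \<Rightarrow> real \<Rightarrow> real \<Rightarrow> real" where
  "mix_coeff k1 k2 k3 = - k3 * (k1 - k2) / (1 + k3)"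

text \<open>For linear \<open>J\<close>, the vectors in parentheses are \<open>J\<close> of the
  parts of \<open>v\<close> and \<open>w\<close> orthogonal to \<open>x\<close>: the difference
  tensor of the sphere must ignore the radial direction.\<close>

definition chr_sym :: "('a \<Rightarrow> 'a) \<Rightarrow> 'a \<Rightarrow> 'a \<Rightarrow> 'a \<Rightarrow> 'a" where
  "chr_sym J x v w = (inverse (x \<bullet> x) * (w \<bullet> J x)) *\<^sub>R (J v - (inverse (x \<bullet> x) * (v \<bullet> x)) *\<^sub>R J x)
     + (inverse (x \<bullet> x) * (v \<bullet> J x)) *\<^sub>R (J w - (inverse (x \<bullet> x) * (w \<bullet> x)) *\<^sub>R J x)"

definition chr_mix :: "('a \<Rightarrow> 'a) \<Rightarrow> ('a \<Rightarrow> 'a) \<Rightarrow> ('a \<Rightarrow> 'a) \<Rightarrow> 'a \<Rightarrow> 'a \<Rightarrow> 'a \<Rightarrow> 'a" where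
  "chr_mix J J' K x v w =
     ((inverse (x \<bullet> x))\<^sup>2 * ((v \<bullet> J x) * (w \<bullet> J' x) + (v \<bullet> J' x) * (w \<bullet> J x))) *\<^sub>R K x"

definition chr_diff :: "real \<Rightarrow> real \<Rightarrow> real \<Rightarrow> 'a \<Rightarrow> 'a \<Rightarrow> 'a \<Rightarrow> 'a" where
  "chr_diff k1 k2 k3 x v w = k1 *\<^sub>R chr_sym J1 x v w + k2 *\<^sub>R chr_sym J2 x v w + k3 *\<^sub>R chr_sym J3
      x v w
    + mix_coeff k1 k2 k3 *\<^sub>R chr_mix J1 J2 J3 x v w + mix_coeff k2 k3 k1 *\<^sub>R chr_mix J2 J3 J1 x v w
    + mix_coeff k3 k1 k2 *\<^sub>R chr_mix J3 J1 J2 x v w"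

text \<open>
  The last summand is the round Christoffel symbol in the chart, where geodesics are straight
  lines. The other two come from the tensor \<open>D\<close>, the difference of the Levi-Civita connections of
  the metric and of the round metric, determined by \<open>g(D(v, w), z) = \<Sum>\<^sub>a k\<^sub>a (\<eta>\<^sub>a(w) \<langle>J\<^sub>a v, z\<rangle> +
  \<eta>\<^sub>a(v) \<langle>J\<^sub>a w, z\<rangle>)\<close> for \<open>s = 1\<close>; subtracting a multiple of \<open>x\<close>, which \<open>radial\<close> does not see,
  makes it tangent at \<open>p\<close>.
\<close>

definition chr_symbol :: "real \<Rightarrow> real \<Rightarrow> real \<Rightarrow> 'a \<Rightarrow> 'a \<Rightarrow> 'a \<Rightarrow> 'a \<Rightarrow> 'a" where
  "chr_symbol k1 k2 k3 p x v w = chr_diff k1 k2 k3 x v w - (chr_diff k1 k2 k3 x v w \<bullet> p) *\<^sub>R x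
     - inverse (x \<bullet> x) *\<^sub>R ((v \<bullet> x) *\<^sub>R w + (w \<bullet> x) *\<^sub>R v)"

lemma chr_symbol_tangent:
  assumes "x \<bullet> p = 1" "v \<in> tangent p" "w \<in> tangent p"
  shows "chr_symbol k1 k2 k3 p x v w \<in> tangent p"
  using assms by (simp add: chr_symbol_def tangent_def inner_diff_left inner_add_left)

lemma pull_metric_radial:
  assumes "x \<noteq> 0"
  shows "pull_metric s k1 k2 k3 x x z = 0"
  using assms by (simp add: pull_metric_def round_part_def eta_part_def power2_eq_square
      inner_commute)

lemma J_inner_same: "J1 x \<bullet> J1 y = x \<bullet> y" "J2 x \<bullet> J2 y = x \<bullet> y" "J3 x \<bullet> J3 y = x \<bullet> y"
  by (simp_all add: J_skew J_mult)

lemma J_inner_diff: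
  "J1 x \<bullet> J2 y = - (x \<bullet> J3 y)" "J2 x \<bullet> J1 y = x \<bullet> J3 y"
  "J2 x \<bullet> J3 y = - (x \<bullet> J1 y)" "J3 x \<bullet> J2 y = x \<bullet> J1 y"
  "J3 x \<bullet> J1 y = - (x \<bullet> J2 y)" "J1 x \<bullet> J3 y = x \<bullet> J2 y"
  by (simp_all add: J_skew J_mult)

lemma J_self' [simp]: "J1 x \<bullet> x = 0" "J2 x \<bullet> x = 0" "J3 x \<bullet> x = 0"
  by (simp_all add: inner_commute[of _ x])

lemma pull_metric_J:
  assumes "x \<noteq> 0"
  shows "pull_metric s k1 k2 k3 x (J1 x) z = s * (1 + k1) * inverse (x \<bullet> x) * (z \<bullet> J1 x)"
    "pull_metric s k1 k2 k3 x (J2 x) z = s * (1 + k2) * inverse (x \<bullet> x) * (z \<bullet> J2 x)"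
    "pull_metric s k1 k2 k3 x (J3 x) z = s * (1 + k3) * inverse (x \<bullet> x) * (z \<bullet> J3 x)"
  using assms by (simp_all add: pull_metric_def round_part_def eta_part_def power2_eq_square
     J_inner_same J_inner_diff inner_commute[of "J1 x" z] inner_commute[of "J2 x" z]
     inner_commute[of "J3 x" z] algebra_simps)

text \<open>Let v' be the part of \<open>v\<close> orthogonal to \<open>x\<close>. In the first
  identity the k1 term drops out since <J1 v', J1 x> = <v', x> = 0, while <J1 v', J2 x> = - <v, J3
  x> and <J1 v', J3 x> = <v, J2 x> give the cross terms; the others are cyclic.\<close>

lemma pull_metric_J_diff:
  assumes "x \<noteq> 0"
  defines "q \<equiv> inverse (x \<bullet> x)"
  shows "pull_metric s k1 k2 k3 x (J1 v - (q * (v \<bullet> x)) *\<^sub>R J1 x) z =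
     s * (q * (z \<bullet> J1 v) - q\<^sup>2 * (v \<bullet> x) * (z \<bullet> J1 x) + q\<^sup>2 * (v \<bullet> J1 x) * (z \<bullet> x)
       - q\<^sup>2 * k2 * (v \<bullet> J3 x) * (z \<bullet> J2 x) + q\<^sup>2 * k3 * (v \<bullet> J2 x) * (z \<bullet> J3 x))"
    "pull_metric s k1 k2 k3 x (J2 v - (q * (v \<bullet> x)) *\<^sub>R J2 x) z =
     s * (q * (z \<bullet> J2 v) - q\<^sup>2 * (v \<bullet> x) * (z \<bullet> J2 x) + q\<^sup>2 * (v \<bullet> J2 x) * (z \<bullet> x)
       - q\<^sup>2 * k3 * (v \<bullet> J1 x) * (z \<bullet> J3 x) + q\<^sup>2 * k1 * (v \<bullet> J3 x) * (z \<bullet> J1 x))"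
    "pull_metric s k1 k2 k3 x (J3 v - (q * (v \<bullet> x)) *\<^sub>R J3 x) z =
     s * (q * (z \<bullet> J3 v) - q\<^sup>2 * (v \<bullet> x) * (z \<bullet> J3 x) + q\<^sup>2 * (v \<bullet> J3 x) * (z \<bullet> x)
       - q\<^sup>2 * k1 * (v \<bullet> J2 x) * (z \<bullet> J1 x) + q\<^sup>2 * k2 * (v \<bullet> J1 x) * (z \<bullet> J2 x))"
proof -
  have q: "q * (x \<bullet> x) = 1" "q * ((x \<bullet> x) * y) = y" for y using assms by simp_all
  have "inverse (x \<bullet> x) = q" by (simp add: q_def)
  then show "pull_metric s k1 k2 k3 x (J1 v - (q * (v \<bullet> x)) *\<^sub>R J1 x) z =
     s * (q * (z \<bullet> J1 v) - q\<^sup>2 * (v \<bullet> x) * (z \<bullet> J1 x) + q\<^sup>2 * (v \<bullet> J1 x) * (z \<bullet> x)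
       - q\<^sup>2 * k2 * (v \<bullet> J3 x) * (z \<bullet> J2 x) + q\<^sup>2 * k3 * (v \<bullet> J2 x) * (z \<bullet> J3 x))"
    "pull_metric s k1 k2 k3 x (J2 v - (q * (v \<bullet> x)) *\<^sub>R J2 x) z =
     s * (q * (z \<bullet> J2 v) - q\<^sup>2 * (v \<bullet> x) * (z \<bullet> J2 x) + q\<^sup>2 * (v \<bullet> J2 x) * (z \<bullet> x)
       - q\<^sup>2 * k3 * (v \<bullet> J1 x) * (z \<bullet> J3 x) + q\<^sup>2 * k1 * (v \<bullet> J3 x) * (z \<bullet> J1 x))"
    "pull_metric s k1 k2 k3 x (J3 v - (q * (v \<bullet> x)) *\<^sub>R J3 x) z =
     s * (q * (z \<bullet> J3 v) - q\<^sup>2 * (v \<bullet> x) * (z \<bullet> J3 x) + q\<^sup>2 * (v \<bullet> J3 x) * (z \<bullet> x)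
       - q\<^sup>2 * k1 * (v \<bullet> J2 x) * (z \<bullet> J1 x) + q\<^sup>2 * k2 * (v \<bullet> J1 x) * (z \<bullet> J2 x))"
    by (simp_all add: pull_metric_def round_part_def eta_part_def inner_diff_left inner_diff_right
        J_inner_same J_inner_diff
      inner_commute[of "J1 v" z] inner_commute[of "J1 x" z] inner_commute[of "J2 v" z]
          inner_commute[of "J2 x" z]
      inner_commute[of "J3 v" z] inner_commute[of "J3 x" z] skew1[of v x] skew2[of v x]
          skew3[of v x]
      power2_eq_square algebra_simps q)
qed

text \<open>The eigenvalue 1 + k_a on the vertical vector cancels the denominator of
  \<open>mix_coeff\<close>. What remains is polynomial and cancels the products of two different k_a
  that \<open>pull_metric_J_diff\<close> contributes.\<close>

lemma pull_metric_chr_mix: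
  assumes "x \<noteq> 0" "k1 > -1" "k2 > -1" "k3 > -1"
  defines "q \<equiv> inverse (x \<bullet> x)"
  shows "mix_coeff k1 k2 k3 * pull_metric s k1 k2 k3 x (chr_mix J1 J2 J3 x v w) z =
      - s * k3 * (k1 - k2) * q^3 * ((v \<bullet> J1 x) * (w \<bullet> J2 x) + (v \<bullet> J2 x) * (w \<bullet> J1 x)) * (z \<bullet> J3 x)"
    "mix_coeff k2 k3 k1 * pull_metric s k1 k2 k3 x (chr_mix J2 J3 J1 x v w) z =
      - s * k1 * (k2 - k3) * q^3 * ((v \<bullet> J2 x) * (w \<bullet> J3 x) + (v \<bullet> J3 x) * (w \<bullet> J2 x)) * (z \<bullet> J1 x)"
    "mix_coeff k3 k1 k2 * pull_metric s k1 k2 k3 x (chr_mix J3 J1 J2 x v w) z =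
      - s * k2 * (k3 - k1) * q^3 * ((v \<bullet> J3 x) * (w \<bullet> J1 x) + (v \<bullet> J1 x) * (w \<bullet> J3 x)) * (z \<bullet> J2 x)"
proof -
  have c: "mix_coeff k1 k2 k3 * (s * (1 + k3) * y) = - s * k3 * (k1 - k2) * y"
     "mix_coeff k2 k3 k1 * (s * (1 + k1) * y) = - s * k1 * (k2 - k3) * y"
     "mix_coeff k3 k1 k2 * (s * (1 + k2) * y) = - s * k2 * (k3 - k1) * y" for y
    using assms by (simp_all add: mix_coeff_def)
  show "mix_coeff k1 k2 k3 * pull_metric s k1 k2 k3 x (chr_mix J1 J2 J3 x v w) z =
      - s * k3 * (k1 - k2) * q^3 * ((v \<bullet> J1 x) * (w \<bullet> J2 x) + (v \<bullet> J2 x) * (w \<bullet> J1 x)) * (z \<bullet> J3 x)"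
    using c(1)[of "q^3 * ((v \<bullet> J1 x) * (w \<bullet> J2 x) + (v \<bullet> J2 x) * (w \<bullet> J1 x)) * (z \<bullet> J3 x)"]
    by (simp only: chr_mix_def pull_metric_linear pull_metric_J[OF assms(1)] q_def[symmetric]
        power2_eq_square power3_eq_cube ac_simps)
  show "mix_coeff k2 k3 k1 * pull_metric s k1 k2 k3 x (chr_mix J2 J3 J1 x v w) z =
      - s * k1 * (k2 - k3) * q^3 * ((v \<bullet> J2 x) * (w \<bullet> J3 x) + (v \<bullet> J3 x) * (w \<bullet> J2 x)) * (z \<bullet> J1 x)"
    using c(2)[of "q^3 * ((v \<bullet> J2 x) * (w \<bullet> J3 x) + (v \<bullet> J3 x) * (w \<bullet> J2 x)) * (z \<bullet> J1 x)"]
    by (simp only: chr_mix_def pull_metric_linear pull_metric_J[OF assms(1)] q_def[symmetric]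
        power2_eq_square power3_eq_cube ac_simps)
  show "mix_coeff k3 k1 k2 * pull_metric s k1 k2 k3 x (chr_mix J3 J1 J2 x v w) z =
      - s * k2 * (k3 - k1) * q^3 * ((v \<bullet> J3 x) * (w \<bullet> J1 x) + (v \<bullet> J1 x) * (w \<bullet> J3 x)) * (z \<bullet> J2 x)"
    using c(3)[of "q^3 * ((v \<bullet> J3 x) * (w \<bullet> J1 x) + (v \<bullet> J1 x) * (w \<bullet> J3 x)) * (z \<bullet> J2 x)"]
    by (simp only: chr_mix_def pull_metric_linear pull_metric_J[OF assms(1)] q_def[symmetric]
        power2_eq_square power3_eq_cube ac_simps)
qed

text \<open>The multiple of \<open>x\<close> that makes the symbol tangent is invisible to the form,
  and all products of two k_a cancel. The lowered symbol is thus affine in the k_a for fixed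
  \<open>s\<close>, as are the derivatives of the metric on the right.\<close>

lemma koszul:
  assumes "x \<noteq> 0" "k1 > -1" "k2 > -1" "k3 > -1"
  shows "2 * pull_metric s k1 k2 k3 x (chr_symbol k1 k2 k3 p x v w) z =
    d_pull_metric s k1 k2 k3 x v w z + d_pull_metric s k1 k2 k3 x w v z - d_pull_metric s k1 k2 k3
        x z v w"
proof -
  define q where "q = inverse (x \<bullet> x)"
  have q: "q * (x \<bullet> x) = 1" using assms by (simp add: q_def)
  have i: "inverse (x \<bullet> x) = q" by (simp add: q_def)
  have P: "pull_metric s k1 k2 k3 x w z = s * (q * (w \<bullet> z) - q\<^sup>2 * (w \<bullet> x) * (z \<bullet> x) + q\<^sup>2 * k1 *
      (w \<bullet> J1 x) * (z \<bullet> J1 x)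
    + q\<^sup>2 * k2 * (w \<bullet> J2 x) * (z \<bullet> J2 x) + q\<^sup>2 * k3 * (w \<bullet> J3 x) * (z \<bullet> J3 x))" for w
    by (simp add: pull_metric_def round_part_def eta_part_def i algebra_simps)
  have B: "pull_metric s k1 k2 k3 x (chr_sym J x v w) z =
      inverse (x \<bullet> x) * (w \<bullet> J x) * pull_metric s k1 k2 k3 x
          (J v - (inverse (x \<bullet> x) * (v \<bullet> x)) *\<^sub>R J x) z
    + inverse (x \<bullet> x) * (v \<bullet> J x) * pull_metric s k1 k2 k3 x
        (J w - (inverse (x \<bullet> x) * (w \<bullet> x)) *\<^sub>R J x) z" for J
    by (simp only: chr_sym_def pull_metric_linear(1,3))
  have sk: "v \<bullet> J1 w = - (w \<bullet> J1 v)" "v \<bullet> J2 w = - (w \<bullet> J2 v)" "v \<bullet> J3 w = - (w \<bullet> J3 v)" for v w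
    using J_skew[of v w] by (simp_all add: inner_commute)
  have "pull_metric s k1 k2 k3 x (chr_symbol k1 k2 k3 p x v w) z =
     s * (- q\<^sup>2 * (v \<bullet> x) * (w \<bullet> z) - q\<^sup>2 * (w \<bullet> x) * (v \<bullet> z) + 2 * q^3 * (v \<bullet> x) * (w \<bullet> x) *
         (z \<bullet> x)
     + k1 * (q\<^sup>2 * ((w \<bullet> J1 x) * (z \<bullet> J1 v) + (v \<bullet> J1 x) * (z \<bullet> J1 w))
        + 2 * q^3 * ((v \<bullet> J1 x) * (w \<bullet> J1 x) * (z \<bullet> x) - (w \<bullet> J1 x) * (v \<bullet> x) * (z \<bullet> J1 x) -
            (v \<bullet> J1 x) * (w \<bullet> x) * (z \<bullet> J1 x)))
     + k2 * (q\<^sup>2 * ((w \<bullet> J2 x) * (z \<bullet> J2 v) + (v \<bullet> J2 x) * (z \<bullet> J2 w))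
        + 2 * q^3 * ((v \<bullet> J2 x) * (w \<bullet> J2 x) * (z \<bullet> x) - (w \<bullet> J2 x) * (v \<bullet> x) * (z \<bullet> J2 x) -
            (v \<bullet> J2 x) * (w \<bullet> x) * (z \<bullet> J2 x)))
     + k3 * (q\<^sup>2 * ((w \<bullet> J3 x) * (z \<bullet> J3 v) + (v \<bullet> J3 x) * (z \<bullet> J3 w))
        + 2 * q^3 * ((v \<bullet> J3 x) * (w \<bullet> J3 x) * (z \<bullet> x) - (w \<bullet> J3 x) * (v \<bullet> x) * (z \<bullet> J3 x) -
            (v \<bullet> J3 x) * (w \<bullet> x) * (z \<bullet> J3 x))))"
    unfolding chr_symbol_def chr_diff_def pull_metric_linear
    unfolding B pull_metric_J_diff[OF assms(1)] pull_metric_chr_mix[OF assms]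
        pull_metric_radial[OF assms(1)]
    unfolding i P[of v] P[of w]
    by algebra
  then show ?thesis
    unfolding d_pull_metric_def d_round_part_def d_eta_part_def Let_def i
      sk[of w v] sk[of w z] sk[of v z]
      inner_commute[of z v] inner_commute[of z w] inner_commute[of w v]
    by algebra
qed

text \<open>Two solutions differ by a vector tangent at \<open>p\<close> that the form pairs to zero
  with itself, so positivity on \<open>tangent p\<close> makes the definite description
  determinate.\<close>

lemma christoffel_metric:
  assumes "s > 0" "k1 > -1" "k2 > -1" "k3 > -1" "x \<bullet> p = 1" "v \<in> tangent p" "w \<in> tangent p"
  shows "christoffel (metric s k1 k2 k3) p x v w = chr_symbol k1 k2 k3 p x v w"
proof -
  have x: "x \<noteq> 0" using assms(5) by auto
  show ?thesis
    unfolding christoffel_def radial_pullback_metric[OF x] dir_deriv_metric[OF x]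
  proof (rule the_equality)
    show "chr_symbol k1 k2 k3 p x v w \<in> tangent p \<and>
        (\<forall>z\<in>tangent p. 2 * pull_metric s k1 k2 k3 x (chr_symbol k1 k2 k3 p x v w) z =
      d_pull_metric s k1 k2 k3 x v w z + d_pull_metric s k1 k2 k3 x w v z - d_pull_metric s k1 k2
          k3 x z v w)"
      using koszul[OF x assms(2-4)] chr_symbol_tangent[OF assms(5-7)] by blast
  next
    fix y
    let ?G = "chr_symbol k1 k2 k3 p x v w"
    assume y: "y \<in> tangent p \<and> (\<forall>z\<in>tangent p. 2 * pull_metric s k1 k2 k3 x y z =
      d_pull_metric s k1 k2 k3 x v w z + d_pull_metric s k1 k2 k3 x w v z - d_pull_metric s k1 k2
          k3 x z v w)"
    have t: "y - ?G \<in> tangent p"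
      using y chr_symbol_tangent[OF assms(5-7)] by (simp add: tangent_def inner_diff_left)
    then have "pull_metric s k1 k2 k3 x (y - ?G) (y - ?G) = 0"
      using y koszul[OF x assms(2-4), of s p v w "y - ?G"]
          pull_metric_linear(2)[of s k1 k2 k3 x y ?G "y - ?G"]
      by fastforce
    then have "y - ?G = 0" using pull_metric_pos[OF assms(1-5) t] by fastforce
    then show "y = ?G" by simp
  qed
qed

end

subsection \<open>Curvature at the base point of the chart\<close>

definition endo_trace :: "('a::euclidean_space \<Rightarrow> 'a) \<Rightarrow> real" where
  "endo_trace f = (\<Sum>b\<in>Basis. f b \<bullet> b)"

text \<open>Rules that evaluate the trace of any combination of the identity and rank-one maps
  symbolically, so that no basis adapted to \<open>p\<close> has to be chosen.\<close>

lemma endo_trace_simps: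
  fixes c d :: "'a::euclidean_space"
  shows "endo_trace (\<lambda>b. f b + g b) = endo_trace f + endo_trace g"
    "endo_trace (\<lambda>b. f b - g b) = endo_trace f - endo_trace g"
    "endo_trace (\<lambda>b. - f b) = - endo_trace f"
    "endo_trace (\<lambda>b. r *\<^sub>R f b) = r * endo_trace f"
    "endo_trace (\<lambda>b. (r * \<phi> b) *\<^sub>R d) = r * endo_trace (\<lambda>b. \<phi> b *\<^sub>R d)"
    "endo_trace (\<lambda>b. (\<phi> b * r) *\<^sub>R d) = r * endo_trace (\<lambda>b. \<phi> b *\<^sub>R d)"
    "endo_trace (\<lambda>b. (\<phi> b + \<psi> b) *\<^sub>R d) = endo_trace (\<lambda>b. \<phi> b *\<^sub>R d) + endo_trace (\<lambda>b. \<psi> b *\<^sub>R d)"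
    "endo_trace (\<lambda>b. (\<phi> b - \<psi> b) *\<^sub>R d) = endo_trace (\<lambda>b. \<phi> b *\<^sub>R d) - endo_trace (\<lambda>b. \<psi> b *\<^sub>R d)"
    "endo_trace (\<lambda>b. (- \<phi> b) *\<^sub>R d) = - endo_trace (\<lambda>b. \<phi> b *\<^sub>R d)"
    "endo_trace (\<lambda>b. (b \<bullet> c) *\<^sub>R d) = c \<bullet> d"
    "endo_trace (\<lambda>b. (c \<bullet> b) *\<^sub>R d) = c \<bullet> d"
    "endo_trace (\<lambda>b. 0) = 0"
    "endo_trace (\<lambda>b::'a. b) = real DIM('a)"
proof -
  show "endo_trace (\<lambda>b. (b \<bullet> c) *\<^sub>R d) = c \<bullet> d"
    unfolding endo_trace_def by (simp add: euclidean_inner[of c d] inner_commute)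
  then show "endo_trace (\<lambda>b. (c \<bullet> b) *\<^sub>R d) = c \<bullet> d"
    by (simp add: inner_commute)
qed (simp_all add: endo_trace_def inner_add_left inner_diff_left sum.distrib sum_subtractf
      sum_negf sum_distrib_left algebra_simps)

context quat_triple begin

lemma endo_trace_J:
  "endo_trace J1 = 0" "endo_trace J2 = 0" "endo_trace J3 = 0"
  "endo_trace (\<lambda>b. (J1 b \<bullet> c) *\<^sub>R d) = - (J1 c \<bullet> d)"
  "endo_trace (\<lambda>b. (J2 b \<bullet> c) *\<^sub>R d) = - (J2 c \<bullet> d)"
  "endo_trace (\<lambda>b. (J3 b \<bullet> c) *\<^sub>R d) = - (J3 c \<bullet> d)"
  "endo_trace (\<lambda>b. (c \<bullet> J1 b) *\<^sub>R d) = - (J1 c \<bullet> d)"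
  "endo_trace (\<lambda>b. (c \<bullet> J2 b) *\<^sub>R d) = - (J2 c \<bullet> d)"
  "endo_trace (\<lambda>b. (c \<bullet> J3 b) *\<^sub>R d) = - (J3 c \<bullet> d)"
proof -
  show "endo_trace J1 = 0" "endo_trace J2 = 0" "endo_trace J3 = 0"
    by (simp_all add: endo_trace_def)
  show 1: "endo_trace (\<lambda>b. (J1 b \<bullet> c) *\<^sub>R d) = - (J1 c \<bullet> d)"
    "endo_trace (\<lambda>b. (J2 b \<bullet> c) *\<^sub>R d) = - (J2 c \<bullet> d)"
    "endo_trace (\<lambda>b. (J3 b \<bullet> c) *\<^sub>R d) = - (J3 c \<bullet> d)"
    by (simp_all only: J_skew(1)[of _ c] J_skew(2)[of _ c] J_skew(3)[of _ c] endo_trace_simps)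
  show "endo_trace (\<lambda>b. (c \<bullet> J1 b) *\<^sub>R d) = - (J1 c \<bullet> d)"
    "endo_trace (\<lambda>b. (c \<bullet> J2 b) *\<^sub>R d) = - (J2 c \<bullet> d)"
    "endo_trace (\<lambda>b. (c \<bullet> J3 b) *\<^sub>R d) = - (J3 c \<bullet> d)"
    using 1 by (simp_all only: inner_commute[of c])
qed

definition chr_sym0 :: "('a \<Rightarrow> 'a) \<Rightarrow> 'a \<Rightarrow> 'a \<Rightarrow> 'a \<Rightarrow> 'a" where
  "chr_sym0 J p v w = (w \<bullet> J p) *\<^sub>R J v + (v \<bullet> J p) *\<^sub>R J w"

definition eta_sym :: "('a \<Rightarrow> 'a) \<Rightarrow> ('a \<Rightarrow> 'a) \<Rightarrow> 'a \<Rightarrow> 'a \<Rightarrow> 'a \<Rightarrow> real" where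
  "eta_sym J J' p v w = (v \<bullet> J p) * (w \<bullet> J' p) + (v \<bullet> J' p) * (w \<bullet> J p)"

definition d_chr_sym :: "('a \<Rightarrow> 'a) \<Rightarrow> 'a \<Rightarrow> 'a \<Rightarrow> 'a \<Rightarrow> 'a \<Rightarrow> 'a" where
  "d_chr_sym J p u v w = (w \<bullet> J u) *\<^sub>R J v - ((w \<bullet> J p) * (v \<bullet> u)) *\<^sub>R J p
     + (v \<bullet> J u) *\<^sub>R J w - ((v \<bullet> J p) * (w \<bullet> u)) *\<^sub>R J p"

definition d_chr_mix :: "('a \<Rightarrow> 'a) \<Rightarrow> ('a \<Rightarrow> 'a) \<Rightarrow> ('a \<Rightarrow> 'a) \<Rightarrow> 'a \<Rightarrow> 'a \<Rightarrow> 'a \<Rightarrow> 'a \<Rightarrow> 'a" where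
  "d_chr_mix J J' K p u v w = ((v \<bullet> J u) * (w \<bullet> J' p) + (v \<bullet> J p) * (w \<bullet> J' u)
      + (v \<bullet> J' u) * (w \<bullet> J p) + (v \<bullet> J' p) * (w \<bullet> J u)) *\<^sub>R K p + eta_sym J J' p v w *\<^sub>R K u"

text \<open>The normal component of \<open>chr_diff\<close> at \<open>p\<close>, up to sign; it has
  to be added along \<open>p\<close> to return to the tangent space.\<close>

definition radial_coeff :: "real \<Rightarrow> real \<Rightarrow> real \<Rightarrow> 'a \<Rightarrow> 'a \<Rightarrow> 'a \<Rightarrow> real" where
  "radial_coeff k1 k2 k3 p v w = 2 * (k1 * (v \<bullet> J1 p) * (w \<bullet> J1 p) + k2 * (v \<bullet> J2 p) * (w \<bullet> J2 p)
      + k3 * (v \<bullet> J3 p) * (w \<bullet> J3 p))"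

text \<open>The mixing coefficients \<open>c1\<close>, \<open>c2\<close>, \<open>c3\<close> are free
  here, which keeps the trace computations polynomial; their values with denominators are inserted
  only at the end. For tangent arguments the round symbols vanish at \<open>p\<close>, so this is
  the difference tensor alone.\<close>

definition chr_symbol0 :: "real \<Rightarrow> real \<Rightarrow> real \<Rightarrow> real \<Rightarrow> real \<Rightarrow> real \<Rightarrow> 'a \<Rightarrow> 'a \<Rightarrow> 'a \<Rightarrow> 'a" where
  "chr_symbol0 k1 k2 k3 c1 c2 c3 p v w =
     k1 *\<^sub>R chr_sym0 J1 p v w + k2 *\<^sub>R chr_sym0 J2 p v w + k3 *\<^sub>R chr_sym0 J3 p v w
     + (c3 * eta_sym J1 J2 p v w) *\<^sub>R J3 p + (c1 * eta_sym J2 J3 p v w) *\<^sub>R J1 p +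
         (c2 * eta_sym J3 J1 p v w) *\<^sub>R J2 p
     + radial_coeff k1 k2 k3 p v w *\<^sub>R p"

definition d_chr_diff :: "real \<Rightarrow> real \<Rightarrow> real \<Rightarrow> real \<Rightarrow> real \<Rightarrow> real \<Rightarrow> 'a \<Rightarrow> 'a \<Rightarrow> 'a \<Rightarrow> 'a \<Rightarrow> 'a" where
  "d_chr_diff k1 k2 k3 c1 c2 c3 p u v w =
     k1 *\<^sub>R d_chr_sym J1 p u v w + k2 *\<^sub>R d_chr_sym J2 p u v w + k3 *\<^sub>R d_chr_sym J3 p u v w
     + c3 *\<^sub>R d_chr_mix J1 J2 J3 p u v w + c1 *\<^sub>R d_chr_mix J2 J3 J1 p u v w + c2 *\<^sub>R d_chr_mix J3
         J1 J2 p u v w"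

definition d_chr_symbol :: "real \<Rightarrow> real \<Rightarrow> real \<Rightarrow> real \<Rightarrow> real \<Rightarrow> real \<Rightarrow> 'a \<Rightarrow> 'a \<Rightarrow> 'a \<Rightarrow> 'a \<Rightarrow> 'a" where
  "d_chr_symbol k1 k2 k3 c1 c2 c3 p u v w =
     d_chr_diff k1 k2 k3 c1 c2 c3 p u v w - (d_chr_diff k1 k2 k3 c1 c2 c3 p u v w \<bullet> p) *\<^sub>R p
     + radial_coeff k1 k2 k3 p v w *\<^sub>R u
     - (v \<bullet> u) *\<^sub>R w - (w \<bullet> u) *\<^sub>R v"

lemma chr_diff_base:
  fixes k1 k2 k3 :: real
  assumes "p \<bullet> p = 1" "v \<in> tangent p" "w \<in> tangent p"
  defines "c1 \<equiv> mix_coeff k2 k3 k1" and "c2 \<equiv> mix_coeff k3 k1 k2" and "c3 \<equiv> mix_coeff k1 k2 k3"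
  shows "chr_diff k1 k2 k3 p v w = k1 *\<^sub>R chr_sym0 J1 p v w + k2 *\<^sub>R chr_sym0 J2 p v w + k3 *\<^sub>R
      chr_sym0 J3 p v w
     + (c3 * eta_sym J1 J2 p v w) *\<^sub>R J3 p + (c1 * eta_sym J2 J3 p v w) *\<^sub>R J1 p +
         (c2 * eta_sym J3 J1 p v w) *\<^sub>R J2 p"
    and "chr_diff k1 k2 k3 p v w \<bullet> p = - radial_coeff k1 k2 k3 p v w"
proof -
  have t: "v \<bullet> p = 0" "w \<bullet> p = 0" using assms by (auto simp: tangent_def)
  show 1: "chr_diff k1 k2 k3 p v w = k1 *\<^sub>R chr_sym0 J1 p v w + k2 *\<^sub>R chr_sym0 J2 p v w + k3 *\<^sub>R
      chr_sym0 J3 p v w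
     + (c3 * eta_sym J1 J2 p v w) *\<^sub>R J3 p + (c1 * eta_sym J2 J3 p v w) *\<^sub>R J1 p +
         (c2 * eta_sym J3 J1 p v w) *\<^sub>R J2 p"
    by (simp add: chr_diff_def chr_sym_def chr_mix_def chr_sym0_def eta_sym_def assms(1) t c1_def
        c2_def c3_def)
  show "chr_diff k1 k2 k3 p v w \<bullet> p = - radial_coeff k1 k2 k3 p v w"
    unfolding 1 by (simp add: radial_coeff_def chr_sym0_def inner_add_left skew1[of v] skew2[of v]
        skew3[of v]
      skew1[of w] skew2[of w] skew3[of w] algebra_simps)
qed

lemma chr_symbol_base:
  assumes "p \<bullet> p = 1" "v \<in> tangent p" "w \<in> tangent p"
  shows "chr_symbol k1 k2 k3 p p v w = chr_symbol0 k1 k2 k3 (mix_coeff k2 k3 k1)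
      (mix_coeff k3 k1 k2) (mix_coeff k1 k2 k3) p v w"
  using assms unfolding chr_symbol_def chr_diff_base(2)[OF assms] unfolding
      chr_diff_base(1)[OF assms]
  by (simp add: chr_symbol0_def tangent_def)

lemma line_simps:
  assumes "p \<bullet> p = 1" "u \<in> tangent p" "v \<in> tangent p"
  shows "(p + t *\<^sub>R u) \<bullet> (p + t *\<^sub>R u) = 1 + t\<^sup>2 * (u \<bullet> u)" "v \<bullet> (p + t *\<^sub>R u) = t * (v \<bullet> u)"
  using assms by (simp_all add: tangent_def inner_add_left inner_add_right inner_commute[of p u]
      power2_eq_square)

lemma has_vector_derivative_chr_sym:
  assumes "p \<bullet> p = 1" "u \<in> tangent p" "v \<in> tangent p" "w \<in> tangent p" "linear J"
  shows "((\<lambda>t. chr_sym J (p + t *\<^sub>R u) v w) has_vector_derivative d_chr_sym J p u v w) (at 0)"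
proof -
  \<comment> \<open>1 / |p + t u|^2 is even in \<open>t\<close>, so the normalizing factors do not
    contribute to the first derivative at 0.\<close>
  have q: "((\<lambda>t. inverse (1 + t\<^sup>2 * (u \<bullet> u))) has_real_derivative 0) (at 0)"
    by (auto intro!: derivative_eq_intros)
  show ?thesis
    unfolding chr_sym_def d_chr_sym_def line_simps[OF assms(1,2,3)] line_simps(2)[OF assms(1,2,4)]
    unfolding linear_add[OF assms(5)] linear_scale[OF assms(5)] inner_add_right inner_scaleR_right
    by (auto intro!: derivative_eq_intros q simp: algebra_simps)
qed

lemma has_vector_derivative_chr_mix:
  assumes "p \<bullet> p = 1" "u \<in> tangent p" "v \<in> tangent p" "w \<in> tangent p" "linear J" "linear J'"
      "linear K"
  shows "((\<lambda>t. chr_mix J J' K (p + t *\<^sub>R u) v w) has_vector_derivative d_chr_mix J J' K p u v w)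
      (at 0)"
proof -
  have q: "((\<lambda>t. inverse (1 + t\<^sup>2 * (u \<bullet> u))) has_real_derivative 0) (at 0)"
    by (auto intro!: derivative_eq_intros)
  show ?thesis
    unfolding chr_mix_def d_chr_mix_def eta_sym_def line_simps(1)[OF assms(1,2,3)]
    unfolding linear_add[OF assms(5)] linear_scale[OF assms(5)] linear_add[OF assms(6)]
        linear_scale[OF assms(6)]
      linear_add[OF assms(7)] linear_scale[OF assms(7)] inner_add_right inner_scaleR_right
    by (auto intro!: derivative_eq_intros q simp: algebra_simps)
qed

lemma dir_deriv_chr_symbol:
  assumes "p \<bullet> p = 1" "u \<in> tangent p" "v \<in> tangent p" "w \<in> tangent p"
  shows "dir_deriv (\<lambda>x. chr_symbol k1 k2 k3 p x v w) p u
    = d_chr_symbol k1 k2 k3 (mix_coeff k2 k3 k1) (mix_coeff k3 k1 k2) (mix_coeff k1 k2 k3) p u v w"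
proof -
  let ?dB = "d_chr_diff k1 k2 k3 (mix_coeff k2 k3 k1) (mix_coeff k3 k1 k2) (mix_coeff k1 k2 k3) p
      u v w"
  have B: "((\<lambda>t. chr_diff k1 k2 k3 (p + t *\<^sub>R u) v w) has_vector_derivative ?dB) (at 0)"
    unfolding chr_diff_def d_chr_diff_def
    by (intro has_vector_derivative_add has_vector_derivative_chr_sym has_vector_derivative_chr_mix
      bounded_linear.has_vector_derivative[OF bounded_linear_scaleR_right] assms lin1 lin2 lin3)
  have Bp: "((\<lambda>t. chr_diff k1 k2 k3 (p + t *\<^sub>R u) v w \<bullet> p) has_vector_derivative (?dB \<bullet> p)) (at 0)"
    by (rule bounded_linear.has_vector_derivative[OF bounded_linear_inner_left B])
  have "((\<lambda>t. chr_symbol k1 k2 k3 p (p + t *\<^sub>R u) v w) has_vector_derivative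
     (?dB - (((chr_diff k1 k2 k3 (p + 0 *\<^sub>R u) v w \<bullet> p) *\<^sub>R u + (?dB \<bullet> p) *\<^sub>R (p + 0 *\<^sub>R u)))
       - ((v \<bullet> u) *\<^sub>R w + (w \<bullet> u) *\<^sub>R v))) (at 0)"
    unfolding chr_symbol_def line_simps[OF assms(1-3)] line_simps(2)[OF assms(1,2,4)]
    by (intro has_vector_derivative_diff B has_vector_derivative_scaleR)
      (use Bp in \<open>auto intro!: derivative_eq_intros simp:
          has_real_derivative_iff_has_vector_derivative\<close>)
  then have "dir_deriv (\<lambda>x. chr_symbol k1 k2 k3 p x v w) p u = ?dB -
      (((chr_diff k1 k2 k3 (p + 0 *\<^sub>R u) v w \<bullet> p) *\<^sub>R u + (?dB \<bullet> p) *\<^sub>R (p + 0 *\<^sub>R u)))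
       - ((v \<bullet> u) *\<^sub>R w + (w \<bullet> u) *\<^sub>R v)"
    unfolding dir_deriv_def by (rule vector_derivative_at)
  then show ?thesis
    by (simp add: d_chr_symbol_def chr_diff_base(2) assms)
qed

lemma riemann_curvature_metric:
  assumes "s > 0" "k1 > -1" "k2 > -1" "k3 > -1" "p \<bullet> p = 1" "u \<in> tangent p" "v \<in> tangent p" "w \<in>
      tangent p"
  defines "D \<equiv> chr_symbol0 k1 k2 k3 (mix_coeff k2 k3 k1) (mix_coeff k3 k1 k2) (mix_coeff k1 k2 k3)
      p"
    and "E \<equiv> d_chr_symbol k1 k2 k3 (mix_coeff k2 k3 k1) (mix_coeff k3 k1 k2) (mix_coeff k1 k2 k3) p"
  shows "riemann_curvature (metric s k1 k2 k3) p u v w = E u v w - E v u w + D u (D v w) - D v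
      (D u w)"
proof -
  have d: "dir_deriv (\<lambda>x. christoffel (metric s k1 k2 k3) p x v w) p u = E u v w"
    if "u \<in> tangent p" "v \<in> tangent p" for u v
  proof -
    have "(p + t *\<^sub>R u) \<bullet> p = 1" for t using that assms(5) by (simp add: tangent_def inner_add_left)
    then have "dir_deriv (\<lambda>x. christoffel (metric s k1 k2 k3) p x v w) p u = dir_deriv
        (\<lambda>x. chr_symbol k1 k2 k3 p x v w) p u"
      by (intro dir_deriv_cong_line christoffel_metric assms(1-4,8) that)
    then show ?thesis using dir_deriv_chr_symbol[OF assms(5) that assms(8)] by (simp only: E_def)
  qed
  have c: "christoffel (metric s k1 k2 k3) p p v w = D v w" "D v w \<in> tangent p"
    if "v \<in> tangent p" "w \<in> tangent p" for v w
    using christoffel_metric[OF assms(1-5) that] chr_symbol_base[OF assms(5) that, of k1 k2 k3]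
      chr_symbol_tangent[OF assms(5) that, of k1 k2 k3] by (simp_all only: D_def)
  show ?thesis
    unfolding riemann_curvature_def d[OF assms(6,7)] d[OF assms(7,6)] c(1)[OF assms(6,8)]
      c(1)[OF assms(7,8)] c(1)[OF assms(6) c(2)[OF assms(7,8)]]
          c(1)[OF assms(7) c(2)[OF assms(6,8)]]
    by (rule refl)
qed

section \<open>The four traces in the Ricci contraction\<close>

lemma J_flip:
  "J1 v \<bullet> p = - (v \<bullet> J1 p)" "J2 v \<bullet> p = - (v \<bullet> J2 p)" "J3 v \<bullet> p = - (v \<bullet> J3 p)"
  "p \<bullet> J1 v = - (v \<bullet> J1 p)" "p \<bullet> J2 v = - (v \<bullet> J2 p)" "p \<bullet> J3 v = - (v \<bullet> J3 p)"
  "J1 p \<bullet> v = v \<bullet> J1 p" "J2 p \<bullet> v = v \<bullet> J2 p" "J3 p \<bullet> v = v \<bullet> J3 p"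
  using J_skew[of v p] by (simp_all add: inner_commute)

text \<open>The summand \<open>radial_coeff\<close> times \<open>u\<close> is traced over the
  tangent space, of dimension N - 1. This is the source of the linear term 2 (N - 1) k_a in
  \<open>ricci_ver\<close>, hence of the expansion.\<close>

lemma trace_d_chr_symbol_dir:
  assumes "p \<bullet> p = 1" "v \<in> tangent p" "w \<in> tangent p"
  shows "endo_trace (\<lambda>b. d_chr_symbol k1 k2 k3 c1 c2 c3 p (tangent_proj p b) v w)
    = (real DIM('a) - 1) * radial_coeff k1 k2 k3 p v w - 2 * (1 + k1 + k2 + k3) * (v \<bullet> w)
      + 2 * ((c3 - c2) * (v \<bullet> J1 p) * (w \<bullet> J1 p) + (c1 - c3) * (v \<bullet> J2 p) * (w \<bullet> J2 p)
      + (c2 - c1) * (v \<bullet> J3 p) * (w \<bullet> J3 p))"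
proof -
  have t: "v \<bullet> p = 0" "w \<bullet> p = 0" "p \<bullet> v = 0" "p \<bullet> w = 0" using assms by
      (auto simp: tangent_def inner_commute)
  show ?thesis
    by (simp add: d_chr_symbol_def d_chr_diff_def d_chr_sym_def d_chr_mix_def tangent_proj_def
        endo_trace_simps endo_trace_J t assms(1)
      inner_add_left inner_add_right inner_diff_left inner_diff_right J_lin J_inner_same
          J_inner_diff eta_sym_def)
      (simp add: J_flip[where v=v and p=p] J_flip[where v=w and p=p] inner_commute[of w v]
          algebra_simps)
qed

text \<open>This is the derivative along \<open>v\<close> of the trace of the symbols. The
  difference tensor is trace-free, so only the round symbols contribute and no k_a appears.\<close>

lemma trace_d_chr_symbol_arg:
  assumes "p \<bullet> p = 1" "v \<in> tangent p" "w \<in> tangent p"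
  shows "endo_trace (\<lambda>b. d_chr_symbol k1 k2 k3 c1 c2 c3 p v (tangent_proj p b) w) = - real DIM('a)
      * (v \<bullet> w)"
proof -
  have t: "v \<bullet> p = 0" "w \<bullet> p = 0" "p \<bullet> v = 0" "p \<bullet> w = 0" using assms by
      (auto simp: tangent_def inner_commute)
  show ?thesis
    by (simp add: d_chr_symbol_def d_chr_diff_def d_chr_sym_def d_chr_mix_def tangent_proj_def
        endo_trace_simps endo_trace_J t assms(1)
      inner_add_left inner_add_right inner_diff_left inner_diff_right J_lin J_inner_same
          J_inner_diff eta_sym_def radial_coeff_def)
      (simp add: J_flip[where v=v and p=p] J_flip[where v=w and p=p] inner_commute[of w v]
          algebra_simps)
qed

text \<open>Geometrically, the trace of the difference of two Levi-Civita connections is the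
  differential of the logarithm of the ratio of their volume densities, and this ratio is constant
  here.\<close>

lemma trace_chr_symbol0:
  assumes "p \<bullet> p = 1" "y \<in> tangent p"
  shows "endo_trace (\<lambda>b. chr_symbol0 k1 k2 k3 c1 c2 c3 p (tangent_proj p b) y) = 0"
proof -
  have t: "y \<bullet> p = 0" "p \<bullet> y = 0" using assms by (auto simp: tangent_def inner_commute)
  show ?thesis
    by (simp add: chr_symbol0_def chr_sym0_def tangent_proj_def endo_trace_simps endo_trace_J t
        assms(1)
      inner_add_left inner_add_right inner_diff_left inner_diff_right J_lin J_inner_same
          J_inner_diff eta_sym_def radial_coeff_def)
qed

text \<open>With v = w = J1 p, the difference tensor acts as k1 J1 on the horizontal space, of
  dimension N - 4, which gives - (N - 4) k1^2. It sends J2 p to m3 J3 p and J3 p to m2 J2 p, which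
  gives 2 m2 m3, and kills J1 p.\<close>

lemma trace_chr_symbol0_comp:
  fixes k1 k2 k3 c1 c2 c3 :: real
  assumes "p \<bullet> p = 1" "v \<in> tangent p" "w \<in> tangent p"
  defines "m1 \<equiv> k2 - k3 + c1" and "m2 \<equiv> k3 - k1 + c2" and "m3 \<equiv> k1 - k2 + c3"
  shows "endo_trace (\<lambda>b. chr_symbol0 k1 k2 k3 c1 c2 c3 p v
      (chr_symbol0 k1 k2 k3 c1 c2 c3 p (tangent_proj p b) w)) =
     (2 * m2 * m3 - (real DIM('a) - 4) * k1\<^sup>2) * (v \<bullet> J1 p) * (w \<bullet> J1 p)
   + (2 * m3 * m1 - (real DIM('a) - 4) * k2\<^sup>2) * (v \<bullet> J2 p) * (w \<bullet> J2 p)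
   + (2 * m1 * m2 - (real DIM('a) - 4) * k3\<^sup>2) * (v \<bullet> J3 p) * (w \<bullet> J3 p)"
proof -
  have t: "v \<bullet> p = 0" "w \<bullet> p = 0" "p \<bullet> v = 0" "p \<bullet> w = 0" using assms by
      (auto simp: tangent_def inner_commute)
  show ?thesis
    by (simp add: chr_symbol0_def chr_sym0_def tangent_proj_def endo_trace_simps endo_trace_J t
        assms(1)
      inner_add_left inner_add_right inner_diff_left inner_diff_right J_lin J_mult J_inner_same
          J_inner_diff eta_sym_def radial_coeff_def)
      (simp add: J_flip[where v=v and p=p] J_flip[where v=w and p=p] J_flip[where v=v and p=w]
          inner_commute[of w v] m1_def m2_def m3_def power2_eq_square algebra_simps)
qed

end

subsection \<open>Ricci tensor and constant curvature\<close>

text \<open>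
  In terms of the vertical eigenvalues \<open>x\<^sub>a = 1 + k\<^sub>a\<close>, the Ricci tensor is \<open>N + 4 - 2 (x\<^sub>1 + x\<^sub>2
  + x\<^sub>3)\<close> on horizontal and \<open>2 (x\<^sub>1\<^sup>2 - (x\<^sub>2 - x\<^sub>3)\<^sup>2) / (x\<^sub>2 x\<^sub>3) + (N - 4) x\<^sub>1\<^sup>2\<close> (and
  cyclically) on vertical unit vectors of the round metric, where \<open>N = 4n + 4\<close>. Below, \<open>ricci_ver\<close>
  is the vertical value minus the horizontal one.
\<close>

definition ricci_hor :: "real \<Rightarrow> real \<Rightarrow> real \<Rightarrow> real \<Rightarrow> real" where
  "ricci_hor N a b c = N - 2 - 2 * (a + b + c)"

definition ricci_ver :: "real \<Rightarrow> real \<Rightarrow> real \<Rightarrow> real \<Rightarrow> real" where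
  "ricci_ver N a b c = 2 * (N - 1) * a + 2 * (b * ((c - a) / (1 + b)) - c * ((a - b) / (1 + c)))
     + (N - 4) * a\<^sup>2 - 2 * ((c - a) / (1 + b)) * ((a - b) / (1 + c))"

context quat_triple begin

lemma mix_coeff_add:
  assumes "c > -1"
  shows "a - b + mix_coeff a b c = (a - b) / (1 + c)"
  using assms by (simp add: mix_coeff_def field_simps)

text \<open>The four terms of the curvature are traced separately, and the third contributes
  nothing. Dividing by the horizontal value \<open>r\<close> brings the result into the normal form
  of \<open>metric\<close>.\<close>

lemma ricci_metric:
  assumes "s > 0" "k1 > -1" "k2 > -1" "k3 > -1"
  defines "N \<equiv> real DIM('a)"
  defines "r \<equiv> ricci_hor N k1 k2 k3"
  assumes "r \<noteq> 0"
  shows "ricci (metric s k1 k2 k3) = metric r (ricci_ver N k1 k2 k3 / r)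
    (ricci_ver N k2 k3 k1 / r) (ricci_ver N k3 k1 k2 / r)"
proof (intro ext)
  fix p v w :: 'a
  show "ricci (metric s k1 k2 k3) p v w = metric r (ricci_ver N k1 k2 k3 / r)
    (ricci_ver N k2 k3 k1 / r) (ricci_ver N k3 k1 k2 / r) p v w"
  proof (cases "p \<in> sphere 0 1 \<and> v \<in> tangent p \<and> w \<in> tangent p")
    case True
    then have p: "p \<bullet> p = 1" and v: "v \<in> tangent p" and w: "w \<in> tangent p"
      by (auto simp: dot_square_norm)
    define c1 where "c1 = mix_coeff k2 k3 k1"
    define c2 where "c2 = mix_coeff k3 k1 k2"
    define c3 where "c3 = mix_coeff k1 k2 k3"
    let ?D = "chr_symbol0 k1 k2 k3 c1 c2 c3 p" and ?E = "d_chr_symbol k1 k2 k3 c1 c2 c3 p"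
    have proj: "tangent_proj p b \<in> tangent p" for b
      using p by (simp add: tangent_proj_def tangent_def inner_diff_left)
    have DT: "?D v w \<in> tangent p"
      using chr_symbol_base[OF p v w, of k1 k2 k3] chr_symbol_tangent[OF p v w, of k1 k2 k3]
      by (simp only: c1_def c2_def c3_def)
    have "ricci (metric s k1 k2 k3) p v w
      = endo_trace (\<lambda>b. riemann_curvature (metric s k1 k2 k3) p (tangent_proj p b) v w)"
      using True by (simp add: ricci_def restrict_tensor_def endo_trace_def)
    also have "\<dots> = endo_trace (\<lambda>b. ?E (tangent_proj p b) v w - ?E v (tangent_proj p b) w
      + ?D (tangent_proj p b) (?D v w) - ?D v (?D (tangent_proj p b) w))"
      unfolding riemann_curvature_metric[OF assms(1-4) p proj v w] c1_def c2_def c3_def by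
          (rule refl)
    also have "\<dots> = endo_trace (\<lambda>b. ?E (tangent_proj p b) v w) - endo_trace
        (\<lambda>b. ?E v (tangent_proj p b) w)
      + endo_trace (\<lambda>b. ?D (tangent_proj p b) (?D v w)) - endo_trace
          (\<lambda>b. ?D v (?D (tangent_proj p b) w))"
      by (simp only: endo_trace_simps)
    finally have R: "ricci (metric s k1 k2 k3) p v w = \<dots>" .
    have m: "k2 - k3 + c1 = (k2 - k3) / (1 + k1)" "k3 - k1 + c2 = (k3 - k1) / (1 + k2)"
      "k1 - k2 + c3 = (k1 - k2) / (1 + k3)"
      using assms by (simp_all only: c1_def c2_def c3_def mix_coeff_add)
    have c: "c1 = - (k1 * ((k2 - k3) / (1 + k1)))" "c2 = - (k2 * ((k3 - k1) / (1 + k2)))"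
       "c3 = - (k3 * ((k1 - k2) / (1 + k3)))"
      by (simp_all add: c1_def c2_def c3_def mix_coeff_def)
    have "ricci (metric s k1 k2 k3) p v w = r * (v \<bullet> w)
      + ricci_ver N k1 k2 k3 * (v \<bullet> J1 p) * (w \<bullet> J1 p)
      + ricci_ver N k2 k3 k1 * (v \<bullet> J2 p) * (w \<bullet> J2 p)
      + ricci_ver N k3 k1 k2 * (v \<bullet> J3 p) * (w \<bullet> J3 p)"
      unfolding R trace_d_chr_symbol_dir[OF p v w] trace_d_chr_symbol_arg[OF p v w]
          trace_chr_symbol0[OF p DT]
        trace_chr_symbol0_comp[OF p v w] m
      unfolding r_def N_def ricci_hor_def ricci_ver_def radial_coeff_def c
      by (simp add: algebra_simps power2_eq_square diff_divide_distrib add_divide_distrib)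
    then show ?thesis using True \<open>r \<noteq> 0\<close>
      by (simp add: metric_def restrict_tensor_def algebra_simps)
  qed (auto simp: ricci_def metric_def restrict_tensor_def)
qed

text \<open>At k = 0 the difference tensor vanishes and the curvature tensor is that of the unit
  sphere; the scale \<open>s\<close> turns sectional curvature 1 into 1 / s.\<close>

lemma constant_curvature_metric:
  assumes "s > 0"
  shows "constant_curvature (metric s 0 0 0)"
  unfolding constant_curvature_def
proof (intro exI ballI impI)
  fix p v w :: 'a
  assume p: "p \<in> sphere 0 1" and v: "v \<in> tangent p" and w: "w \<in> tangent p"
    and ind: "v \<noteq> w \<and> independent {v, w}"
  have pp: "p \<bullet> p = 1" using p by (simp add: dot_square_norm)
  define d where "d = (v \<bullet> v) * (w \<bullet> w) - (v \<bullet> w)\<^sup>2"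
  have "w \<noteq> 0" "v \<notin> span {w}" using ind by (auto simp: independent_insert)
  have "d \<noteq> 0"
  proof
    assume "d = 0"
    let ?y = "(w \<bullet> w) *\<^sub>R v - (v \<bullet> w) *\<^sub>R w"
    have "?y \<bullet> ?y = (w \<bullet> w) * d"
      by (simp add: d_def inner_diff_left inner_diff_right inner_commute[of w v] power2_eq_square
          algebra_simps)
    then have "(w \<bullet> w) *\<^sub>R v = (v \<bullet> w) *\<^sub>R w" using \<open>d = 0\<close> by simp
    then have "v = ((v \<bullet> w) / (w \<bullet> w)) *\<^sub>R w"
      using \<open>w \<noteq> 0\<close> by (metis divide_inverse_commute inner_eq_zero_iff real_vector_affinity_eq
          scaleR_left_imp_eq
        scaleR_scaleR vector_fraction_eq_iff)
    then show False using \<open>v \<notin> span {w}\<close> by (metis span_base span_scale singletonI)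
  qed
  have R: "riemann_curvature (metric s 0 0 0) p v w w = (w \<bullet> w) *\<^sub>R v - (v \<bullet> w) *\<^sub>R w"
    using riemann_curvature_metric[OF assms _ _ _ pp v w w, of 0 0 0]
    by (simp add: chr_symbol0_def d_chr_symbol_def d_chr_diff_def radial_coeff_def mix_coeff_def
        inner_commute)
  have M: "metric s 0 0 0 p y z = s * (y \<bullet> z)" if "y \<in> tangent p" "z \<in> tangent p" for y z
    using that p by (simp add: metric_def restrict_tensor_def)
  have T: "(w \<bullet> w) *\<^sub>R v - (v \<bullet> w) *\<^sub>R w \<in> tangent p"
    using v w by (simp add: tangent_def inner_diff_left)
  have "sectional_curvature (metric s 0 0 0) p v w = (s * d) / (s\<^sup>2 * d)"
    unfolding sectional_curvature_def R M[OF T v] M[OF v v] M[OF w w] M[OF v w]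
    by (simp add: d_def inner_diff_left inner_commute[of w v] power2_eq_square algebra_simps)
  then show "sectional_curvature (metric s 0 0 0) p v w = 1 / s"
    using \<open>d \<noteq> 0\<close> assms by (simp add: power2_eq_square)
qed

text \<open>All pullbacks lie in the span of four fixed rational functions, so smooth convergence
  reduces to that of the coefficients. The partial sums \<open>f1\<close>, \<open>f2\<close>,
  \<open>f3\<close> bring in one function at a time.\<close>

lemma smooth_converges_metric:
  assumes "s \<longlonglongrightarrow> s'" "a \<longlonglongrightarrow> a'" "b \<longlonglongrightarrow> b'" "c \<longlonglongrightarrow> c'"
  shows "smooth_converges (\<lambda>i. metric (s i) (a i) (b i) (c i)) (metric s' a' b' c')"
  unfolding smooth_converges_def
proof (intro allI)
  fix v w :: 'a and ds
  have rat: "rat_off_0 (\<lambda>x. round_part x v w)" "rat_off_0 (\<lambda>x. eta_part J1 x v w)"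
     "rat_off_0 (\<lambda>x. eta_part J2 x v w)" "rat_off_0 (\<lambda>x. eta_part J3 x v w)"
    by (intro rat_fun_imp_rat_off_0 rat_round_part rat_eta_part; simp)+
  define f1 where "f1 s x = s * round_part x v w" for s x
  define f2 where "f2 s a x = f1 s x + (s * a) * eta_part J1 x v w" for s a x
  define f3 where "f3 s a b x = f2 s a x + (s * b) * eta_part J2 x v w" for s a b x
  have r: "rat_off_0 (f1 s)" "rat_off_0 (f2 s a)" "rat_off_0 (f3 s a b)" for s a b
    unfolding f1_def[abs_def] f2_def[abs_def] f3_def[abs_def]
    by (intro rat_fun_imp_rat_off_0 rat_fun.add rat_fun.mult rat_fun.const rat_round_part
        rat_eta_part; simp)+
  have r0: "rat_off_0 (\<lambda>x::'a. 0)" by (intro rat_fun_imp_rat_off_0 rat_fun.const)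
  have "uniform_limit (sphere 0 1) (\<lambda>i. iter_dir_deriv ds (\<lambda>x. 0))
      (iter_dir_deriv ds (\<lambda>x::'a. 0 :: real)) sequentially"
    by (rule uniform_limit_const)
  then have "uniform_limit (sphere 0 1) (\<lambda>i. iter_dir_deriv ds (f1 (s i)))
      (iter_dir_deriv ds (f1 s')) sequentially"
    by (rule uniform_limit_iter_dir_deriv_lincomb[OF r0 r0 rat(1) assms(1)]) (simp_all add: f1_def)
  then have "uniform_limit (sphere 0 1) (\<lambda>i. iter_dir_deriv ds (f2 (s i) (a i)))
      (iter_dir_deriv ds (f2 s' a')) sequentially"
    by (rule uniform_limit_iter_dir_deriv_lincomb[OF r(1) r(1) rat(2)
        tendsto_mult[OF assms(1,2)]]) (simp_all add: f2_def)
  then have "uniform_limit (sphere 0 1) (\<lambda>i. iter_dir_deriv ds (f3 (s i) (a i) (b i)))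
      (iter_dir_deriv ds (f3 s' a' b')) sequentially"
    by (rule uniform_limit_iter_dir_deriv_lincomb[OF r(2) r(2) rat(3)
        tendsto_mult[OF assms(1,3)]]) (simp_all add: f3_def)
  then show "uniform_limit (sphere 0 1)
      (\<lambda>i. iter_dir_deriv ds (\<lambda>x. radial_pullback (metric (s i) (a i) (b i) (c i)) x v w))
      (iter_dir_deriv ds (\<lambda>x. radial_pullback (metric s' a' b' c') x v w)) sequentially"
    by (rule uniform_limit_iter_dir_deriv_lincomb[OF r(3) r(3) rat(4) tendsto_mult[OF assms(1,4)]])
      (simp_all add: f1_def f2_def f3_def radial_pullback_metric pull_metric_def algebra_simps)
qed

end

subsection \<open>Backward orbits of the Ricci map\<close>

lemma expanding_backward_orbit:
  fixes f :: "'a::euclidean_space \<Rightarrow> 'a"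
  assumes cont: "continuous_on (ball 0 \<rho>) f" and "\<rho> > 0" and f0: "f 0 = 0"
    and der: "(f has_derivative (\<lambda>h. L *\<^sub>R h)) (at 0)" and L: "L > 1"
  shows "\<exists>\<delta>>0. \<forall>y\<in>ball 0 \<delta>. \<exists>z. z 0 = y \<and> (\<forall>i. f (z (Suc i)) = z i) \<and> (\<forall>i. z i \<in> ball 0 \<rho>) \<and> z \<longlonglongrightarrow> 0"
proof -
  \<comment> \<open>Half of the excess L - 1 is spent on the error of the linear approximation; this
    leaves L - \<epsilon> = (L + 1) / 2 > 1 and the contraction factor q = 2 / (L + 1).\<close>
  define \<epsilon> where "\<epsilon> = (L - 1) / 2"
  define q where "q = 1 / (L - \<epsilon>)"
  have \<epsilon>: "\<epsilon> > 0" "L - \<epsilon> > 1" using L by (auto simp: \<epsilon>_def field_simps)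
  have q: "0 < q" "q < 1" "q * (L - \<epsilon>) = 1" using \<epsilon> by (auto simp: q_def)
  obtain d where d: "d > 0" "\<And>y. norm y < d \<Longrightarrow> norm (f y - L *\<^sub>R y) \<le> \<epsilon> * norm y"
    using der \<epsilon>(1) f0 unfolding has_derivative_at_alt by auto
  define \<delta> where "\<delta> = min d \<rho>"
  have \<delta>: "\<delta> > 0" using d(1) \<open>\<rho> > 0\<close> by (simp add: \<delta>_def)
  have pre: "\<exists>x. f x = y \<and> norm x \<le> q * norm y" if y: "norm y < \<delta>" for y
  proof -
    define r where "r = q * norm y"
    have r: "0 \<le> r" "r \<le> norm y" using q by (auto simp: r_def mult_left_le_one_le)
    have sub: "cball 0 r \<subseteq> ball 0 \<rho>" "\<And>x. x \<in> cball 0 r \<Longrightarrow> norm x < d"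
      using r y by (auto simp: \<delta>_def)
    \<comment> \<open>A Newton step with the derivative frozen at 0; its fixed points solve f x = y.
      It preserves the ball of radius r = q |y| because \<epsilon> r + |y| = \<epsilon> r + (L -
      \<epsilon>) r = L r.\<close>
    define T where "T x = (1 / L) *\<^sub>R (L *\<^sub>R x - f x + y)" for x
    have "continuous_on (cball 0 r) T"
      unfolding T_def by (intro continuous_intros continuous_on_subset[OF cont sub(1)])
    moreover have "T x \<in> cball 0 r" if x: "x \<in> cball 0 r" for x
    proof -
      have "norm (L *\<^sub>R x - f x + y) \<le> norm (f x - L *\<^sub>R x) + norm y"
        by (metis norm_minus_commute norm_triangle_ineq)
      also have "\<dots> \<le> \<epsilon> * r + norm y"
        using d(2)[OF sub(2)[OF x]] x \<epsilon>(1) by (smt (verit) mem_cball_0 mult_left_mono)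
      also have "norm y = (L - \<epsilon>) * r" using q(3) by (simp add: r_def mult.commute)
      finally have "norm (L *\<^sub>R x - f x + y) \<le> L * r" by (simp add: algebra_simps)
      moreover have "norm (T x) = norm (L *\<^sub>R x - f x + y) / L"
        unfolding T_def norm_scaleR using L by simp
      ultimately have "L * norm (T x) \<le> L * r" using L by simp
      then show ?thesis using L by simp
    qed
    ultimately obtain x where x: "x \<in> cball 0 r" "T x = x"
      using brouwer[of "cball 0 r" T] r(1) by (auto simp: Pi_iff)
    have "L *\<^sub>R x - f x + y = L *\<^sub>R T x" using L by (simp add: T_def)
    then have "f x = y" using x(2) by (simp add: algebra_simps)
    then show ?thesis using x(1) by (auto simp: r_def)
  qed
  define g where "g y = (SOME x. f x = y \<and> norm x \<le> q * norm y)" for y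
  have g: "f (g y) = y" "norm (g y) \<le> q * norm y" if "norm y < \<delta>" for y
    using someI_ex[OF pre[OF that]] by (auto simp: g_def)
  show ?thesis
  proof (rule exI[of _ \<delta>], intro conjI ballI)
    fix y :: 'a assume "y \<in> ball 0 \<delta>"
    then have y: "norm y < \<delta>" by simp
    define z where "z i = (g ^^ i) y" for i
    have z: "norm (z i) \<le> q ^ i * norm y" for i
    proof (induction i)
      case (Suc i)
      have "q ^ i * norm y \<le> norm y" using q by (intro mult_left_le_one_le power_le_one) auto
      then have "norm (z i) < \<delta>" using Suc y by linarith
      from g(2)[OF this] have "norm (z (Suc i)) \<le> q * norm (z i)" by (simp add: z_def)
      also have "\<dots> \<le> q * (q ^ i * norm y)" using Suc q by (intro mult_left_mono) auto
      finally show ?case by (simp add: mult.assoc)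
    qed (simp add: z_def)
    have zn: "norm (z i) < \<delta>" for i
    proof -
      have "q ^ i * norm y \<le> norm y" using q by (intro mult_left_le_one_le power_le_one) auto
      then show ?thesis using z[of i] y by linarith
    qed
    have "(\<lambda>i. q ^ i * norm y) \<longlonglongrightarrow> 0"
      using q by (intro tendsto_mult_left_zero LIMSEQ_power_zero) auto
    then have "z \<longlonglongrightarrow> 0" by (rule Lim_null_comparison[rotated]) (simp add: z)
    moreover have "f (z (Suc i)) = z i" for i using g(1)[OF zn] by (simp add: z_def)
    moreover have "z i \<in> ball 0 \<rho>" for i using zn[of i] by (simp add: \<delta>_def)
    ultimately show "\<exists>z. z 0 = y \<and> (\<forall>i. f (z (Suc i)) = z i) \<and> (\<forall>i. z i \<in> ball 0 \<rho>) \<and> z \<longlonglongrightarrow> 0"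
      by (intro exI[of _ z]) (simp add: z_def)
  qed (rule \<delta>)
qed

definition shape_map :: "real \<Rightarrow> real \<times> real \<times> real \<Rightarrow> real \<times> real \<times> real" where
  "shape_map N x = (let a = fst x; b = fst (snd x); c = snd (snd x) in
     (ricci_ver N a b c / ricci_hor N a b c, ricci_ver N b c a / ricci_hor N a b c,
      ricci_ver N c a b / ricci_hor N a b c))"

text \<open>The radius 1/4 is a convenient choice: it keeps every 1 + k_a positive and the
  horizontal Ricci value above N - 2 - 3/2.\<close>

lemma ball_quarter:
  fixes x :: "real \<times> real \<times> real"
  assumes "x \<in> ball 0 (1/4)" "N \<ge> 8"
  shows "fst x > -1" "fst (snd x) > -1" "snd (snd x) > -1"
    "ricci_hor N (fst x) (fst (snd x)) (snd (snd x)) > 0"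
proof -
  have "\<bar>fst x\<bar> \<le> norm x" "norm (snd x) \<le> norm x" "\<bar>fst (snd x)\<bar> \<le> norm (snd x)" "\<bar>snd (snd x)\<bar> \<le>
      norm (snd x)"
    using norm_fst_le[of "fst x" "snd x"] norm_snd_le[of "snd x" "fst x"]
        norm_fst_le[of "fst (snd x)" "snd (snd x)"]
     norm_snd_le[of "snd (snd x)" "fst (snd x)"] by auto
  then have "\<bar>fst x\<bar> < 1/4" "\<bar>fst (snd x)\<bar> < 1/4" "\<bar>snd (snd x)\<bar> < 1/4" using assms(1) by auto
  then show "fst x > -1" "fst (snd x) > -1" "snd (snd x) > -1"
    "ricci_hor N (fst x) (fst (snd x)) (snd (snd x)) > 0"
    using assms(2) by (auto simp: ricci_hor_def)
qed

lemma shape_map_backward_orbit: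
  assumes N: "N \<ge> 8"
  shows "\<exists>\<delta>>0. \<forall>y\<in>ball 0 \<delta>. \<exists>z. z 0 = y \<and> (\<forall>i. shape_map N (z (Suc i)) = z i) \<and>
    (\<forall>i. z i \<in> ball 0 (1/4)) \<and> z \<longlonglongrightarrow> 0"
proof (rule expanding_backward_orbit)
  have "\<forall>x\<in>ball 0 (1/4). 1 + fst x \<noteq> 0 \<and> 1 + fst (snd x) \<noteq> 0 \<and> 1 + snd (snd x) \<noteq> 0
      \<and> N - 2 - 2 * (fst x + fst (snd x) + snd (snd x)) \<noteq> 0"
    using ball_quarter[OF _ N] by (smt (verit) ricci_hor_def)
  then show "continuous_on (ball 0 (1/4)) (shape_map N)"
    unfolding shape_map_def Let_def ricci_ver_def ricci_hor_def
    by (intro continuous_intros) auto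
  \<comment> \<open>Apart from 2 (N - 1) a, every term of \<open>ricci_ver\<close> is a product of
    two factors vanishing at 0. As the numerator vanishes there, only the value N - 2 of the
    denominator enters.\<close>
  show "(shape_map N has_derivative (\<lambda>h. (2 * (N - 1) / (N - 2)) *\<^sub>R h)) (at 0)"
  proof -
    have "((\<lambda>x. shape_map N x) has_derivative (\<lambda>h. (2 * (N - 1) / (N - 2) * fst h,
        2 * (N - 1) / (N - 2) * fst (snd h), 2 * (N - 1) / (N - 2) * snd (snd h)))) (at 0)"
      unfolding shape_map_def Let_def ricci_ver_def ricci_hor_def
      by (intro has_derivative_Pair; (rule derivative_eq_intros refl | use N in simp)+;
          use N in \<open>simp add: fun_eq_iff divide_simps algebra_simps\<close>)
    then show ?thesis by (simp add: scaleR_prod_def)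
  qed
  show "1 < 2 * (N - 1) / (N - 2)" using N by (simp add: field_simps)
qed (simp_all add: shape_map_def ricci_ver_def zero_prod_def)

context quat_triple begin

lemma scale_tensor_metric: "scale_tensor c (metric s k1 k2 k3) = metric (c * s) k1 k2 k3"
  by (auto simp: scale_tensor_def metric_def restrict_tensor_def fun_eq_iff)

lemma ricci_iteration_metric:
  fixes z :: "nat \<Rightarrow> real \<times> real \<times> real"
  assumes "s > 0" "DIM('a) \<ge> 8" and z: "\<And>i. shape_map DIM('a) (z (Suc i)) = z i"
    "\<And>i. z i \<in> ball 0 (1/4)" "z \<longlonglongrightarrow> 0"
  defines "g0 \<equiv> metric s (fst (z 0)) (fst (snd (z 0))) (snd (snd (z 0)))"
  shows "\<exists>c>0. \<exists>g. ricci_iteration_from (scale_tensor c g0) g \<and>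
           (\<exists>h. riemannian_metric h \<and> constant_curvature h \<and> smooth_converges g h)"
proof -
  have N: "real DIM('a) \<ge> 8" using assms(2) by linarith
  define rh where "rh i = ricci_hor DIM('a) (fst (z i)) (fst (snd (z i))) (snd (snd (z i)))" for i
  \<comment> \<open>The shape has index \<open>i\<close>, but the scale has index
    \<open>Suc i\<close>: Ricci of any metric of shape z (Suc i) has shape z i and horizontal value
    rh (Suc i).\<close>
  define g where "g i = metric (rh (Suc i)) (fst (z i)) (fst (snd (z i))) (snd (snd (z i)))" for i
  note zb = ball_quarter[OF z(2) N]
  have rh: "rh i > 0" for i using zb(4) by (simp add: rh_def)
  have riem: "riemannian_metric (g i)" for i
    unfolding g_def by (intro riemannian_metric_metric rh zb)
  have ric: "ricci (metric t (fst (z (Suc i))) (fst (snd (z (Suc i)))) (snd (snd (z (Suc i)))))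
     = metric (rh (Suc i)) (fst (z i)) (fst (snd (z i))) (snd (snd (z i)))" if "t > 0" for t i
    unfolding rh_def z(1)[of i, symmetric] shape_map_def Let_def fst_conv snd_conv
    by (intro ricci_metric that zb less_imp_neq[symmetric])
  have "ricci (g (i + 1)) = g i" for i
    using ric[OF rh, of "Suc (Suc i)" i] by (simp add: g_def)
  \<comment> \<open>The constant \<open>c\<close> rescales \<open>g0\<close> from \<open>s\<close>
    to rh 1, the scale that Ricci of shape z 1 dictates; the result is \<open>g 0\<close>.\<close>
  moreover have "ricci (g 1) = scale_tensor (rh 1 / s) g0"
    using ric[OF rh, of 2 0] \<open>s > 0\<close> by (simp add: g_def g0_def scale_tensor_metric numeral_2_eq_2)
  ultimately have it: "ricci_iteration_from (scale_tensor (rh 1 / s) g0) g"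
    using riem by (simp add: ricci_iteration_from_def)
  have lim: "(\<lambda>i. fst (z i)) \<longlonglongrightarrow> 0" "(\<lambda>i. fst (snd (z i))) \<longlonglongrightarrow> 0" "(\<lambda>i. snd (snd (z i))) \<longlonglongrightarrow> 0"
    using tendsto_fst[OF z(3)] tendsto_fst[OF tendsto_snd[OF z(3)]]
        tendsto_snd[OF tendsto_snd[OF z(3)]]
    by simp_all
  have "rh \<longlonglongrightarrow> real DIM('a) - 2 - 2 * (0 + 0 + 0)"
    unfolding rh_def ricci_hor_def by (intro tendsto_intros lim)
  then have "(\<lambda>i. rh (Suc i)) \<longlonglongrightarrow> real DIM('a) - 2"
    by (intro LIMSEQ_Suc) simp
  then have "smooth_converges g (metric (real DIM('a) - 2) 0 0 0)"
    unfolding g_def by (intro smooth_converges_metric lim)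
  moreover have "riemannian_metric (metric (real DIM('a) - 2) 0 0 0)"
    using N by (intro riemannian_metric_metric) auto
  moreover have "constant_curvature (metric (real DIM('a) - 2) 0 0 0)"
    using N by (intro constant_curvature_metric) auto
  moreover have "rh 1 / s > 0" using rh \<open>s > 0\<close> by simp
  ultimately show ?thesis using it by blast
qed

end

subsection \<open>Quaternionic reflections\<close>

lemmas quat_expand = qmult_def qcnj_def qone_def inner_prod_def inner_complex_def prod_eq_iff
  complex_eq_iff scaleR_prod_def

lemma qmult_assoc: "qmult (qmult p q) r = qmult p (qmult q r)"
  by (simp add: quat_expand algebra_simps)

lemma qmult_linear:
  "qmult (p + q) r = qmult p r + qmult q r" "qmult r (p + q) = qmult r p + qmult r q"
  "qmult (p - q) r = qmult p r - qmult q r" "qmult r (p - q) = qmult r p - qmult r q"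
  "qmult (- p) r = - qmult p r" "qmult r (- p) = - qmult r p"
  "qmult (a *\<^sub>R p) r = a *\<^sub>R qmult p r" "qmult r (a *\<^sub>R p) = a *\<^sub>R qmult r p"
  "qmult 0 r = 0" "qmult r 0 = 0" "qmult qone r = r" "qmult r qone = r"
  by (simp_all add: quat_expand algebra_simps)

lemma qmult_sum_left: "qmult (\<Sum>k\<in>K. f k) r = (\<Sum>k\<in>K. qmult (f k) r)"
  by (induction K rule: infinite_finite_induct) (simp_all add: qmult_linear)

lemma qmult_sum_right: "qmult r (\<Sum>k\<in>K. f k) = (\<Sum>k\<in>K. qmult r (f k))"
  by (induction K rule: infinite_finite_induct) (simp_all add: qmult_linear)

lemma qcnj_simps:
  "qcnj (p + q) = qcnj p + qcnj q" "qcnj (p - q) = qcnj p - qcnj q" "qcnj (- p) = - qcnj p"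
  "qcnj 0 = 0" "qcnj (qcnj p) = p" "qcnj qone = qone" "qcnj (a *\<^sub>R p) = a *\<^sub>R qcnj p"
  "qcnj (qmult p q) = qmult (qcnj q) (qcnj p)"
  by (simp_all add: quat_expand algebra_simps)

lemma qcnj_sum: "qcnj (\<Sum>k\<in>K. f k) = (\<Sum>k\<in>K. qcnj (f k))"
  by (induction K rule: infinite_finite_induct) (simp_all add: qcnj_simps)

lemma qmult_qcnj: "qmult (qcnj p) p = (p \<bullet> p) *\<^sub>R qone" "qmult p (qcnj p) = (p \<bullet> p) *\<^sub>R qone"
  by (simp_all add: quat_expand algebra_simps)

lemma qadd_qcnj: "p + qcnj p = (2 * (p \<bullet> qone)) *\<^sub>R qone"
  by (simp add: quat_expand)

lemma qone_inner [simp]: "qone \<bullet> qone = 1"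
  by (simp add: quat_expand)

lemma qmult_inner: "qmult p e \<bullet> q = e \<bullet> qmult (qcnj p) q" "qmult e p \<bullet> q = e \<bullet> qmult q (qcnj p)"
  by (simp_all add: quat_expand algebra_simps)

section \<open>The quaternionic Hermitian form and right multiplication\<close>

definition herm :: "quat ^ 'm::finite \<Rightarrow> quat ^ 'm \<Rightarrow> quat" where
  "herm x y = (\<Sum>k\<in>UNIV. qmult (qcnj (x $ k)) (y $ k))"

text \<open>Right multiplications commute with the matrices and compose in reverse order. This is
  why the product of \<open>rmul e1\<close> and \<open>rmul e2\<close> belongs to
  \<open>qmult e2 e1\<close>.\<close>

definition rmul :: "quat \<Rightarrow> quat ^ 'm::finite \<Rightarrow> quat ^ 'm" where
  "rmul e x = (\<chi> k. qmult (x $ k) e)"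

text \<open>The bridge between real and quaternionic orthogonality: the quaternion
  \<open>herm x y\<close> records the real inner products of \<open>y\<close> with all right
  multiples of \<open>x\<close>.\<close>

lemma rmul_inner: "rmul e x \<bullet> y = e \<bullet> herm x y"
  by (simp add: rmul_def herm_def inner_vec_def inner_sum_right qmult_inner)

lemma rmul_linear:
  "rmul (e + f) x = rmul e x + rmul f x" "rmul (a *\<^sub>R e) x = a *\<^sub>R rmul e x"
  "rmul (- e) x = - rmul e x" "rmul qone x = x" "rmul 0 x = 0" "rmul e 0 = 0"
  "rmul e (x + y) = rmul e x + rmul e y" "rmul e (a *\<^sub>R x) = a *\<^sub>R rmul e x"
  "rmul e (rmul f x) = rmul (qmult f e) x"
  by (simp_all add: rmul_def vec_eq_iff qmult_linear qmult_assoc)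

lemma inner_herm: "x \<bullet> y = qone \<bullet> herm x y"
  using rmul_inner[of qone x y] by (simp add: rmul_linear)

lemma herm_simps:
  "herm (x + y) z = herm x z + herm y z" "herm z (x + y) = herm z x + herm z y"
  "herm (x - y) z = herm x z - herm y z" "herm z (x - y) = herm z x - herm z y"
  "herm (- x) z = - herm x z" "herm z (- x) = - herm z x"
  "herm (a *\<^sub>R x) z = a *\<^sub>R herm x z" "herm z (a *\<^sub>R x) = a *\<^sub>R herm z x"
  "herm x (rmul e z) = qmult (herm x z) e"
  by (simp_all add: herm_def rmul_def qmult_linear qcnj_simps sum.distrib sum_subtractf sum_negf
      scaleR_sum_right qmult_sum_left qmult_assoc)

lemma qcnj_herm: "qcnj (herm x y) = herm y x"
  by (simp add: herm_def qcnj_sum qcnj_simps)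

lemma herm_self: "herm x x = (x \<bullet> x) *\<^sub>R qone"
  by (simp add: herm_def qmult_qcnj inner_vec_def scaleR_sum_left)

lemma rmul_inner_rmul: "rmul e x \<bullet> rmul f x = (x \<bullet> x) * (e \<bullet> f)"
  by (simp add: rmul_inner herm_simps herm_self qmult_linear)

lemma qmat_vec_rmul: "qmat_vec A (rmul e x) = rmul e (qmat_vec A x)"
  by (simp add: qmat_vec_def rmul_def vec_eq_iff qmult_sum_left qmult_assoc)

lemma herm_qmat_vec:
  fixes x y :: "quat ^ 'm::finite"
  assumes "A \<in> Sp"
  shows "herm (qmat_vec A x) (qmat_vec A y) = herm x y"
proof -
  have "herm (qmat_vec A x) (qmat_vec A y) = (\<Sum>k\<in>UNIV. \<Sum>i\<in>UNIV. \<Sum>j\<in>UNIV.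
      qmult (qcnj (x $ i)) (qmult (qmult (qcnj (A $ k $ i)) (A $ k $ j)) (y $ j)))"
    by (simp only: herm_def qmat_vec_def vec_lambda_beta qcnj_sum qmult_sum_left)
      (simp add: qmult_sum_right qcnj_simps qmult_assoc)
  also have "\<dots> = (\<Sum>i\<in>UNIV. \<Sum>k\<in>UNIV. \<Sum>j\<in>UNIV.
      qmult (qcnj (x $ i)) (qmult (qmult (qcnj (A $ k $ i)) (A $ k $ j)) (y $ j)))"
    by (rule sum.swap)
  also have "\<dots> = (\<Sum>i\<in>UNIV. \<Sum>j\<in>UNIV. \<Sum>k\<in>UNIV.
      qmult (qcnj (x $ i)) (qmult (qmult (qcnj (A $ k $ i)) (A $ k $ j)) (y $ j)))"
    by (intro sum.cong refl sum.swap)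
  also have "\<dots> = (\<Sum>i\<in>UNIV. \<Sum>j\<in>UNIV. qmult (qcnj (x $ i))
      (qmult (\<Sum>k\<in>UNIV. qmult (qcnj (A $ k $ i)) (A $ k $ j)) (y $ j)))"
    by (simp add: qmult_sum_left qmult_sum_right)
  also have "\<dots> = (\<Sum>i\<in>UNIV. \<Sum>j\<in>UNIV. if j = i then qmult (qcnj (x $ i)) (y $ j) else 0)"
    using assms by (intro sum.cong refl) (simp add: Sp_def qmult_linear)
  also have "\<dots> = herm x y" by (simp add: herm_def)
  finally show ?thesis .
qed

lemma inner_qmat_vec: "A \<in> Sp \<Longrightarrow> qmat_vec A x \<bullet> qmat_vec A y = x \<bullet> y"
  by (simp add: inner_herm herm_qmat_vec)

text \<open>
  The quaternionic analogue \<open>x \<mapsto> x + d \<alpha> \<langle>d, x\<rangle>\<close> of a Householder reflection, with \<open>d = u - w\<close>. It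
  preserves the Hermitian form iff \<open>\<alpha> + cnj \<alpha> + |d|\<^sup>2 |\<alpha>|\<^sup>2 = 0\<close>, and \<open>\<alpha> = - \<langle>d, u\<rangle>\<^sup>-\<^sup>1\<close> is what
  sends \<open>u\<close> to \<open>w\<close>.
\<close>

lemma Sp_reflection:
  fixes u w :: "quat ^ 'm::finite"
  assumes "u \<bullet> u = w \<bullet> w"
  shows "\<exists>A\<in>Sp. qmat_vec A u = w \<and> (\<forall>x. herm (u - w) x = 0 \<longrightarrow> qmat_vec A x = x)"
proof -
  define d where "d = u - w"
  define \<beta> where "\<beta> = herm d u"
  \<comment> \<open>This is the negative inverse of \<beta>. If u = w, then \<beta> = 0, and inverse
    0 = 0 makes \<open>A\<close> the identity.\<close>
  define \<alpha> where "\<alpha> = (- inverse (\<beta> \<bullet> \<beta>)) *\<^sub>R qcnj \<beta>"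
  define A where "A = (\<chi> i j. (if i = j then qone else 0) + qmult (d $ i) (qmult \<alpha> (qcnj (d $ j))))"
  have dd: "d \<bullet> d = 2 * (\<beta> \<bullet> qone)"
  proof -
    have "d \<bullet> d = 2 * (u \<bullet> u - w \<bullet> u)"
      using assms by (simp add: d_def inner_diff_left inner_diff_right inner_commute)
    also have "u \<bullet> u - w \<bullet> u = \<beta> \<bullet> qone"
      using inner_herm[of d u] by (simp add: \<beta>_def d_def inner_diff_left inner_diff_right
          inner_commute)
    finally show ?thesis .
  qed
  have act: "qmat_vec A x = x + rmul (qmult \<alpha> (herm d x)) d" for x
  proof -
    have "qmult ((if i = j then qone else 0) + qmult (d $ i) (qmult \<alpha> (qcnj (d $ j)))) (x $ j)
      = (if j = i then x $ i else 0) + qmult (d $ i) (qmult \<alpha> (qmult (qcnj (d $ j)) (x $ j)))" for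
          i j
      by (simp add: qmult_linear qmult_assoc)
    then show ?thesis
      by (simp add: vec_eq_iff qmat_vec_def A_def rmul_def herm_def sum.distrib qmult_sum_right)
  qed
  have \<beta>: "\<beta> = 0 \<Longrightarrow> d = 0" using dd by simp
  have \<alpha>: "\<alpha> + qcnj \<alpha> + (d \<bullet> d) *\<^sub>R qmult (qcnj \<alpha>) \<alpha> = 0"
  proof (cases "\<beta> = 0")
    case False
    have "\<alpha> + qcnj \<alpha> = (- inverse (\<beta> \<bullet> \<beta>) * (2 * (\<beta> \<bullet> qone))) *\<^sub>R qone"
      using qadd_qcnj[of "qcnj \<beta>"] unfolding \<alpha>_def
      by (simp add: quat_expand)
    moreover have "qmult (qcnj \<alpha>) \<alpha> = inverse (\<beta> \<bullet> \<beta>) *\<^sub>R qone"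
      using False by (simp add: \<alpha>_def qcnj_simps qmult_linear qmult_qcnj)
    ultimately show ?thesis by (simp add: dd flip: scaleR_add_left) 
  qed (simp add: \<alpha>_def qcnj_simps qmult_linear)
  have "A \<in> Sp"
  proof -
    have "(\<Sum>k\<in>UNIV. qmult (qcnj (A $ k $ i)) (A $ k $ j)) = (if i = j then qone else 0)" for i j
    proof -
      have "qmult (qcnj (A $ k $ i)) (A $ k $ j) = (if k = i then if i = j then qone else 0 else 0)
        + (if k = i then qmult (d $ i) (qmult \<alpha> (qcnj (d $ j))) else 0)
        + (if k = j then qmult (d $ i) (qmult (qcnj \<alpha>) (qcnj (d $ j))) else 0)
        + qmult (d $ i) (qmult (qcnj \<alpha>) (qmult (qmult (qcnj (d $ k)) (d $ k))
            (qmult \<alpha> (qcnj (d $ j)))))" for k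
        by (simp add: A_def qcnj_simps qmult_linear qmult_assoc)
      then have "(\<Sum>k\<in>UNIV. qmult (qcnj (A $ k $ i)) (A $ k $ j)) = (if i = j then qone else 0)
        + qmult (d $ i) (qmult \<alpha> (qcnj (d $ j))) + qmult (d $ i) (qmult (qcnj \<alpha>) (qcnj (d $ j)))
        + qmult (d $ i) (qmult (qcnj \<alpha>) (qmult (herm d d) (qmult \<alpha> (qcnj (d $ j)))))"
        by (simp add: sum.distrib herm_def qmult_sum_left qmult_sum_right)
      also have "\<dots> = (if i = j then qone else 0)
        + qmult (d $ i) (qmult (\<alpha> + qcnj \<alpha> + (d \<bullet> d) *\<^sub>R qmult (qcnj \<alpha>) \<alpha>) (qcnj (d $ j)))"
        by (simp add: herm_self qmult_linear qmult_assoc)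
      finally show ?thesis by (simp add: \<alpha> qmult_linear)
    qed
    then show ?thesis by (simp add: Sp_def)
  qed
  moreover have "qmat_vec A u = w"
  proof (cases "\<beta> = 0")
    case True
    then show ?thesis using \<beta> by (simp add: act d_def rmul_linear)
  next
    case False
    then have "qmult \<alpha> (herm d u) = - qone"
      by (simp add: \<alpha>_def flip: \<beta>_def) (simp add: qmult_linear qmult_qcnj)
    then show ?thesis by (simp add: act rmul_linear) (simp add: d_def)
  qed
  moreover have "qmat_vec A x = x" if "herm (u - w) x = 0" for x
    using that by (simp add: act qmult_linear rmul_linear flip: d_def)
  ultimately show ?thesis by blast
qed

text \<open>\<open>e\<close> maximizes the quadratic form on the unit sphere of \<open>S\<close>, so
  the first variation vanishes in directions orthogonal to it. A general subspace \<open>S\<close>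
  allows a second use on the complement of a first eigenvector.\<close>

lemma bilinear_eigenvector:
  fixes B :: "'a::euclidean_space \<Rightarrow> 'a \<Rightarrow> real"
  assumes B: "bilinear B" and sym: "\<And>x y. B x y = B y x" and S: "subspace S" "x0 \<in> S" "x0 \<noteq> 0"
  shows "\<exists>e\<in>S. norm e = 1 \<and> (\<forall>f\<in>S. f \<bullet> e = 0 \<longrightarrow> B e f = 0)"
proof -
  let ?K = "S \<inter> sphere 0 1"
  have "compact ?K" using closed_subspace[OF S(1)] by (simp add: closed_Int_compact)
  moreover have "x0 /\<^sub>R norm x0 \<in> ?K" using S by (simp add: subspace_scale)
  moreover have "continuous_on ?K (\<lambda>x. B x x)"
    by (intro bounded_bilinear.continuous_on[OF B[unfolded bilinear_conv_bounded_bilinear]]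
        continuous_on_id)
  ultimately obtain e where e: "e \<in> ?K" "\<And>x. x \<in> ?K \<Longrightarrow> B x x \<le> B e e"
    using continuous_attains_sup[of ?K "\<lambda>x. B x x"] by blast
  have le: "B y y \<le> B e e * (y \<bullet> y)" if "y \<in> S" for y
  proof (cases "y = 0")
    case True
    then show ?thesis using bilinear_lzero[OF B] by simp
  next
    case False
    then have "y /\<^sub>R norm y \<in> ?K" using that S by (simp add: subspace_scale)
    from e(2)[OF this] have "B y y / (norm y)\<^sup>2 \<le> B e e"
      by (simp add: bilinear_lmul[OF B] bilinear_rmul[OF B] power2_eq_square field_simps)
    then show ?thesis using False by (simp add: field_simps dot_square_norm)
  qed
  have "B e f = 0" if f: "f \<in> S" "f \<bullet> e = 0" for f
  proof -
    have ee: "e \<bullet> e = 1" using e(1) by (simp add: dot_square_norm)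
    define c where "c = B e e * (f \<bullet> f) - B f f"
    have ineq: "2 * t * B e f \<le> t\<^sup>2 * c" for t
    proof -
      have "e + t *\<^sub>R f \<in> S" using e(1) f S by (simp add: subspace_add subspace_scale)
      from le[OF this] show ?thesis
        by (simp add: bilinear_ladd[OF B] bilinear_radd[OF B] bilinear_lmul[OF B]
            bilinear_rmul[OF B]
          sym[of f e] inner_add_left inner_add_right f(2) inner_commute[of e f] ee c_def
          power2_eq_square algebra_simps)
    qed
    \<comment> \<open>With this \<open>t\<close> the inequality reads 2 t^2 (|c| + 1) \<le> t^2 c,
      which forces t = 0; the summand 1 keeps the denominator positive.\<close>
    define t where "t = B e f / (\<bar>c\<bar> + 1)"
    have t: "B e f = t * (\<bar>c\<bar> + 1)" by (simp add: t_def)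
    have "2 * t\<^sup>2 * (\<bar>c\<bar> + 1) \<le> t\<^sup>2 * c" using ineq[of t] by
        (simp add: t power2_eq_square mult.assoc)
    also have "t\<^sup>2 * c \<le> t\<^sup>2 * (\<bar>c\<bar> + 1)" by (intro mult_left_mono) auto
    finally have "t\<^sup>2 * (\<bar>c\<bar> + 1) \<le> 0" by linarith
    then have "t = 0" by (auto simp: mult_le_0_iff)
    then show ?thesis using t by simp
  qed
  then show ?thesis using e(1) by auto
qed

subsection \<open>Invariant metrics\<close>

lemma qcnj_imaginary: "e \<bullet> qone = 0 \<Longrightarrow> qcnj e = - e"
  by (simp add: quat_expand)

lemma qmult_imaginary:
  assumes "e \<bullet> qone = 0" "f \<bullet> qone = 0"
  shows "qmult e f = - qmult f e - (2 * (e \<bullet> f)) *\<^sub>R qone"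
  using assms by (simp add: quat_expand algebra_simps)

lemma qmult_orthonormal:
  assumes "e1 \<bullet> qone = 0" "e2 \<bullet> qone = 0" "e1 \<bullet> e1 = 1" "e2 \<bullet> e2 = 1" "e1 \<bullet> e2 = 0"
  defines "e3 \<equiv> qmult e2 e1"
  shows "e3 \<bullet> qone = 0" "e3 \<bullet> e3 = 1" "e3 \<bullet> e1 = 0" "e3 \<bullet> e2 = 0"
proof -
  show "e3 \<bullet> qone = 0" unfolding e3_def qmult_inner(1)
    using assms by (simp add: qcnj_imaginary qmult_linear inner_commute)
  show "e3 \<bullet> e2 = 0" unfolding e3_def qmult_inner(1) qmult_qcnj using assms by simp
  show "e3 \<bullet> e3 = 1" unfolding e3_def qmult_inner(1)
    using assms by (simp add: qmult_qcnj qmult_linear flip: qmult_assoc)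
  show "e3 \<bullet> e1 = 0" unfolding e3_def qmult_inner(2) using assms by (simp add: qmult_qcnj)
qed

text \<open>
  A quaternion orthogonal to \<open>1\<close>, \<open>e\<^sub>1\<close> and \<open>e\<^sub>2\<close> anticommutes with \<open>e\<^sub>1\<close> and \<open>e\<^sub>2\<close>, so it
  commutes with \<open>e\<^sub>2 e\<^sub>1\<close>; if it is orthogonal to \<open>e\<^sub>2 e\<^sub>1\<close> as well, it also anticommutes with it.
\<close>

lemma quaternion_orthogonal_basis:
  assumes e: "e1 \<bullet> qone = 0" "e2 \<bullet> qone = 0" "e1 \<bullet> e1 = 1" "e2 \<bullet> e2 = 1" "e1 \<bullet> e2 = 0"
    and q: "q \<bullet> qone = 0" "q \<bullet> e1 = 0" "q \<bullet> e2 = 0" "q \<bullet> qmult e2 e1 = 0"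
  shows "q = 0"
proof -
  let ?e3 = "qmult e2 e1"
  note e3 = qmult_orthonormal[OF e]
  have "qmult q ?e3 = - qmult ?e3 q"
    using qmult_imaginary[OF q(1) e3(1)] q(4) by simp
  moreover have "qmult q ?e3 = qmult ?e3 q"
  proof -
    have "qmult q ?e3 = qmult (qmult q e2) e1" by (simp add: qmult_assoc)
    also have "qmult q e2 = - qmult e2 q" using qmult_imaginary[OF q(1) e(2)] q(3) by simp
    also have "qmult (- qmult e2 q) e1 = - qmult e2 (qmult q e1)" by
        (simp add: qmult_linear qmult_assoc)
    also have "qmult q e1 = - qmult e1 q" using qmult_imaginary[OF q(1) e(1)] q(2) by simp
    finally show ?thesis by (simp add: qmult_linear qmult_assoc)
  qed
  ultimately have "qmult q ?e3 = 0" by (simp add: prod_eq_iff complex_eq_iff)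
  then have "qmult q (qmult ?e3 (qcnj ?e3)) = 0" by (simp add: qmult_linear flip: qmult_assoc)
  then show ?thesis using e3(2) by (simp add: qmult_qcnj qmult_linear)
qed

lemma quat_triple_rmul:
  assumes "e1 \<bullet> qone = 0" "e2 \<bullet> qone = 0" "e1 \<bullet> e1 = 1" "e2 \<bullet> e2 = 1" "e1 \<bullet> e2 = 0"
  shows "quat_triple (rmul e1 :: quat ^ 'm::finite \<Rightarrow> _) (rmul e2) (rmul (qmult e2 e1))"
proof
  have skew: "rmul e x \<bullet> y = - (x \<bullet> rmul e y)" if "e \<bullet> qone = 0" for e and x y :: "quat ^ 'm"
  proof -
    have "x \<bullet> rmul e y = e \<bullet> qcnj (herm x y)" by (simp add: inner_commute[of x] rmul_inner
        qcnj_herm)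
    also have "\<dots> = qcnj e \<bullet> herm x y" by (simp add: quat_expand)
    finally show ?thesis using that by (simp add: rmul_inner qcnj_imaginary)
  qed
  have sq: "rmul e (rmul e x) = - x" if "e \<bullet> qone = 0" "e \<bullet> e = 1" for e and x :: "quat ^ 'm"
  proof -
    have "- qmult e e = qone" using qmult_qcnj(1)[of e] that by
        (simp add: qcnj_imaginary qmult_linear)
    then have "qmult e e = - qone" by (metis minus_minus)
    then show ?thesis by (simp add: rmul_linear)
  qed
  fix x y :: "quat ^ 'm"
  show "rmul e1 x \<bullet> y = - (x \<bullet> rmul e1 y)" "rmul e2 x \<bullet> y = - (x \<bullet> rmul e2 y)"
    "rmul e1 (rmul e1 x) = - x" "rmul e2 (rmul e2 x) = - x"
    using assms skew sq by auto
  show "rmul e1 (rmul e2 x) = rmul (qmult e2 e1) x" by (simp add: rmul_linear)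
  have "qmult e1 e2 = - qmult e2 e1" using qmult_imaginary[OF assms(1,2)] assms(5) by simp
  then show "rmul e2 (rmul e1 x) = - rmul (qmult e2 e1) x" by (simp add: rmul_linear)
qed (simp_all add: rmul_linear)

lemma rmul_tangent: "e \<bullet> qone = 0 \<Longrightarrow> rmul e p \<in> tangent p"
  by (simp add: tangent_def rmul_inner herm_self)

lemma horizontal_tangent: "herm p u = 0 \<Longrightarrow> u \<in> tangent p"
  using inner_herm[of p u] by (simp add: tangent_def inner_commute)

lemma riemannian_linear:
  assumes "riemannian_metric g" "p \<in> sphere 0 1" "u \<in> tangent p" "v \<in> tangent p" "w \<in> tangent p"
  shows "g p (u + v) w = g p u w + g p v w" "g p w (u + v) = g p w u + g p w v"
    "g p (c *\<^sub>R u) w = c * g p u w" "g p w (c *\<^sub>R u) = c * g p w u" "g p u v = g p v u"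
    "g p (- u) w = - g p u w"
proof -
  have lin: "g p (a *\<^sub>R u + b *\<^sub>R v) w = a * g p u w + b * g p v w" if "u \<in> tangent p" "v \<in>
      tangent p" for u v a b
    using assms(1,2,5) that by (simp add: riemannian_metric_def)
  have sym: "g p v w = g p w v" if "v \<in> tangent p" "w \<in> tangent p" for v w
    using assms(1,2) that by (simp add: riemannian_metric_def)
  have t: "u + v \<in> tangent p" "c *\<^sub>R u \<in> tangent p"
    using assms by (auto simp: tangent_def inner_add_left)
  show 1: "g p (u + v) w = g p u w + g p v w" using lin[of u v 1 1] assms by simp
  show 2: "g p (c *\<^sub>R u) w = c * g p u w" for c using lin[of u u c 0] assms by simp
  show "g p w (u + v) = g p w u + g p w v" "g p w (c *\<^sub>R u) = c * g p w u"
    using 1 2[of c] sym[OF t(1) assms(5)] sym[OF t(2) assms(5)] sym[OF assms(3,5)]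
        sym[OF assms(4,5)]
    by simp_all
  show "g p u v = g p v u" using sym assms by auto
  show "g p (- u) w = - g p u w" using 2[of "-1"] by simp
qed

section \<open>Values forced by invariance\<close>

lemma homogeneous_metric_Sp:
  assumes "g \<in> homogeneous_metrics" "A \<in> Sp" "p \<in> sphere 0 1" "v \<in> tangent p" "w \<in> tangent p"
  shows "g (qmat_vec A p) (qmat_vec A v) (qmat_vec A w) = g p v w"
  using assms by (simp add: homogeneous_metrics_def Sp_invariant_def)

text \<open>A symplectic matrix taking \<open>p\<close> to \<open>p'\<close> commutes with right
  multiplications and therefore carries p e to p' e: right multiplication trivializes the vertical
  bundle invariantly.\<close>

lemma homogeneous_metric_vertical:
  assumes g: "g \<in> homogeneous_metrics" and p: "p \<in> sphere 0 1" "p' \<in> sphere 0 1"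
    and e: "e \<bullet> qone = 0" "f \<bullet> qone = 0"
  shows "g p' (rmul e p') (rmul f p') = g p (rmul e p) (rmul f p)"
proof -
  have "p \<bullet> p = p' \<bullet> p'" using p by (simp add: dot_square_norm)
  from Sp_reflection[OF this] obtain A where A: "A \<in> Sp" "qmat_vec A p = p'" by blast
  then have "g (qmat_vec A p) (qmat_vec A (rmul e p)) (qmat_vec A (rmul f p)) = g p (rmul e p)
      (rmul f p)"
    by (intro homogeneous_metric_Sp g p(1) rmul_tangent e)
  then show ?thesis by (simp add: qmat_vec_rmul A(2))
qed

text \<open>The reflection sending \<open>u\<close> to \<open>- u\<close> fixes \<open>p\<close>,
  hence every right multiple of \<open>p\<close>, so the pairing equals its own negative.\<close>

lemma homogeneous_metric_cross:
  assumes g: "g \<in> homogeneous_metrics" and p: "p \<in> sphere 0 1"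
    and u: "herm p u = 0" and e: "e \<bullet> qone = 0"
  shows "g p u (rmul e p) = 0"
proof -
  have "u \<bullet> u = (- u) \<bullet> (- u)" by simp
  from Sp_reflection[OF this] obtain A where A: "A \<in> Sp" "qmat_vec A u = - u"
    "\<And>x. herm (u - (- u)) x = 0 \<Longrightarrow> qmat_vec A x = x" by blast
  have "herm u p = 0" using qcnj_herm[of p u] u by (simp add: qcnj_simps)
  then have Ap: "qmat_vec A p = p" by (intro A(3)) (simp add: herm_simps)
  have "g (qmat_vec A p) (qmat_vec A u) (qmat_vec A (rmul e p)) = g p u (rmul e p)"
    by (intro homogeneous_metric_Sp g p A(1) horizontal_tangent u rmul_tangent e)
  then have "g p (- u) (rmul e p) = g p u (rmul e p)" by (simp add: qmat_vec_rmul A(2) Ap)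
  moreover have "g p (- u) (rmul e p) = - g p u (rmul e p)"
    using g p horizontal_tangent[OF u] rmul_tangent[OF e]
    by (intro riemannian_linear(6)[of g p u u]) (auto simp: homogeneous_metrics_def)
  ultimately show ?thesis by simp
qed

text \<open>Two reflections are composed: one moves \<open>p\<close> to \<open>p'\<close>, and a
  second, fixing \<open>p'\<close>, moves the image of \<open>u\<close> to
  \<open>u'\<close>.\<close>

lemma homogeneous_metric_horizontal_norm:
  assumes g: "g \<in> homogeneous_metrics" and p: "p \<in> sphere 0 1" "p' \<in> sphere 0 1"
    and u: "herm p u = 0" "herm p' u' = 0" "u \<bullet> u = u' \<bullet> u'"
  shows "g p' u' u' = g p u u"
proof -
  have inv: "g (qmat_vec A q) (qmat_vec A v) (qmat_vec A v) = g q v v"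
    if "A \<in> Sp" "q \<in> sphere 0 1" "herm q v = 0" for A q v
    by (intro homogeneous_metric_Sp g that(1,2) horizontal_tangent that(3))
  have "p \<bullet> p = p' \<bullet> p'" using p by (simp add: dot_square_norm)
  from Sp_reflection[OF this] obtain A where A: "A \<in> Sp" "qmat_vec A p = p'" by blast
  let ?w = "qmat_vec A u"
  have w: "herm p' ?w = 0" using herm_qmat_vec[OF A(1), of p u] A(2) u(1) by simp
  have "?w \<bullet> ?w = u' \<bullet> u'" using inner_qmat_vec[OF A(1)] u(3) by simp
  from Sp_reflection[OF this] obtain B where B: "B \<in> Sp" "qmat_vec B ?w = u'"
    "\<And>x. herm (?w - u') x = 0 \<Longrightarrow> qmat_vec B x = x" by blast
  have "herm ?w p' = 0" "herm u' p' = 0"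
    using qcnj_herm[of p' ?w] qcnj_herm[of p' u'] w u(2) by (simp_all add: qcnj_simps)
  then have "qmat_vec B p' = p'" by (intro B(3)) (simp add: herm_simps)
  then have "g p' u' u' = g p' ?w ?w" using inv[OF B(1) p(2) w] B(2) by simp
  also have "\<dots> = g p u u" using inv[OF A(1) p(1) u(1)] A(2) by simp
  finally show ?thesis .
qed

text \<open>By the previous lemma the quadratic form is a multiple of the squared norm, with the
  same factor at all points; polarization gives the bilinear form.\<close>

lemma homogeneous_metric_horizontal:
  assumes g: "g \<in> homogeneous_metrics" and p: "p \<in> sphere 0 1" "p' \<in> sphere 0 1"
    and u0: "herm p u0 = 0" "u0 \<bullet> u0 = 1" and u: "herm p' u = 0" "herm p' w = 0"
  shows "g p' u w = g p u0 u0 * (u \<bullet> w)"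
proof -
  have riem: "riemannian_metric g" using g by (simp add: homogeneous_metrics_def)
  have diag: "g p' u u = g p u0 u0 * (u \<bullet> u)" if "herm p' u = 0" for u
  proof -
    have "g p' u u = g p (norm u *\<^sub>R u0) (norm u *\<^sub>R u0)"
    proof (rule homogeneous_metric_horizontal_norm[OF g p])
      show "herm p (norm u *\<^sub>R u0) = 0" using u0(1) by (simp add: herm_simps)
      show "norm u *\<^sub>R u0 \<bullet> norm u *\<^sub>R u0 = u \<bullet> u"
        using u0(2) by (simp add: dot_square_norm[of u] power2_eq_square)
    qed (rule that)
    also have "\<dots> = norm u * (norm u * g p u0 u0)"
    proof -
      have 0: "u0 \<in> tangent p" "norm u *\<^sub>R u0 \<in> tangent p"
        using u0(1) by (auto intro!: horizontal_tangent simp: herm_simps)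
      show ?thesis
        using riemannian_linear(3)[OF riem p(1) 0(1) 0(1) 0(2)]
            riemannian_linear(4)[OF riem p(1) 0(1) 0(1) 0(1)]
        by simp
    qed
    finally show ?thesis by (simp add: dot_square_norm power2_eq_square)
  qed
  have t: "u \<in> tangent p'" "w \<in> tangent p'" "u + w \<in> tangent p'" "herm p' (u + w) = 0"
    using u by (auto intro!: horizontal_tangent simp: herm_simps)
  have "g p' (u + w) (u + w) = g p' u u + 2 * g p' u w + g p' w w"
    using riemannian_linear(1)[OF riem p(2) t(1,2,3)] riemannian_linear(2)[OF riem p(2) t(1,2,1)]
      riemannian_linear(2)[OF riem p(2) t(1,2,2)] riemannian_linear(5)[OF riem p(2) t(1,2,1)] by
          simp
  then show ?thesis
    unfolding diag[OF t(4)] diag[OF u(1)] diag[OF u(2)]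
    by (simp add: inner_add_left inner_add_right inner_commute[of w u] algebra_simps)
qed

text \<open>The diagonalizing unit vectors vary with the metric. Values on a fixed basis bound the
  form at all of them, and these are what an open condition can prescribe.\<close>

lemma bilinear_abs_le:
  fixes B :: "'a::euclidean_space \<Rightarrow> 'a \<Rightarrow> real"
  assumes "bilinear B" "norm e = 1"
  shows "\<bar>B e e\<bar> \<le> (\<Sum>b\<in>Basis. \<Sum>b'\<in>Basis. \<bar>B b b'\<bar>)"
proof -
  have "B e e = B (\<Sum>b\<in>Basis. (e \<bullet> b) *\<^sub>R b) (\<Sum>b\<in>Basis. (e \<bullet> b) *\<^sub>R b)"
    by (simp add: euclidean_representation)
  also have "\<dots> = (\<Sum>(b, b')\<in>Basis \<times> Basis. B ((e \<bullet> b) *\<^sub>R b) ((e \<bullet> b') *\<^sub>R b'))"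
    by (rule bilinear_sum[OF assms(1)])
  also have "\<dots> = (\<Sum>b\<in>Basis. \<Sum>b'\<in>Basis. (e \<bullet> b) * ((e \<bullet> b') * B b b'))"
    by (simp add: sum.cartesian_product bilinear_lmul[OF assms(1)] bilinear_rmul[OF assms(1)]
      mult.left_commute)
  finally have eq: "B e e = (\<Sum>b\<in>Basis. \<Sum>b'\<in>Basis. (e \<bullet> b) * ((e \<bullet> b') * B b b'))" .
  show ?thesis
    unfolding eq
  proof (intro order_trans[OF sum_abs] sum_mono)
    fix b b' :: 'a assume b: "b \<in> Basis" "b' \<in> Basis"
    have "\<bar>e \<bullet> b\<bar> \<le> 1" "\<bar>e \<bullet> b'\<bar> \<le> 1"
      using Basis_le_norm[of b e] Basis_le_norm[of b' e] b assms(2) by simp_all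
    then have "\<bar>e \<bullet> b'\<bar> * \<bar>B b b'\<bar> \<le> 1 * \<bar>B b b'\<bar>" "\<bar>e \<bullet> b\<bar> * (\<bar>e \<bullet> b'\<bar> * \<bar>B b b'\<bar>) \<le> 1 *
        (\<bar>e \<bullet> b'\<bar> * \<bar>B b b'\<bar>)"
      by (intro mult_right_mono; simp)+
    then show "\<bar>(e \<bullet> b) * ((e \<bullet> b') * B b b')\<bar> \<le> \<bar>B b b'\<bar>"
      by (simp add: abs_mult)
  qed
qed

section \<open>Diagonal form of an invariant metric\<close>

lemma tangent_proj_tangent:
  assumes "p \<in> sphere 0 1"
  shows "tangent_proj p v \<in> tangent p"
  using assms by (simp add: tangent_proj_def tangent_def inner_diff_left dot_square_norm)

lemma tangent_proj_linear:
  "tangent_proj p (u + v) = tangent_proj p u + tangent_proj p v"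
  "tangent_proj p (c *\<^sub>R u) = c *\<^sub>R tangent_proj p u"
  "v \<in> tangent p \<Longrightarrow> tangent_proj p v = v"
  by (simp_all add: tangent_proj_def tangent_def inner_add_left scaleR_add_left algebra_simps)

text \<open>Extension by zero makes \<open>g p\<close> itself fail to be bilinear on the ambient
  space; composing with the projection repairs this and keeps the values on tangent vectors.\<close>

lemma bilinear_riemannian:
  assumes "riemannian_metric g" "p \<in> sphere 0 1"
  shows "bilinear (\<lambda>v w. g p (tangent_proj p v) (tangent_proj p w))"
proof -
  note t = tangent_proj_tangent[OF assms(2)]
  show ?thesis
    unfolding bilinear_def
    by (intro conjI allI linearI; simp only: tangent_proj_linear
        riemannian_linear(1)[OF assms t t t]
        riemannian_linear(2)[OF assms t t t] riemannian_linear(3)[OF assms t t t]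
        riemannian_linear(4)[OF assms t t t] real_scaleR_def)
qed

lemma exists_imaginary_orthogonal:
  fixes e :: quat
  shows "\<exists>x. x \<noteq> 0 \<and> x \<bullet> qone = 0 \<and> x \<bullet> e = 0"
proof -
  define i j :: quat where "i = (\<i>, 0)" and "j = (0, 1)"
  have ij: "i \<noteq> 0" "i \<bullet> qone = 0" "j \<bullet> qone = 0" "i \<bullet> j = 0" "j \<bullet> j = 1"
    by (simp_all add: i_def j_def quat_expand zero_prod_def)
  show ?thesis
  proof (cases "i \<bullet> e = 0")
    case False
    let ?x = "(j \<bullet> e) *\<^sub>R i - (i \<bullet> e) *\<^sub>R j"
    have "?x \<bullet> j \<noteq> 0" using False ij by (simp add: inner_diff_left)
    then have "?x \<noteq> 0" by (metis inner_zero_left)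
    moreover have "?x \<bullet> qone = 0" "?x \<bullet> e = 0" using ij by (simp_all add: inner_diff_left)
    ultimately show ?thesis by blast
  qed (use ij in blast)
qed

text \<open>The units are successive eigenvectors of the vertical form at \<open>p\<close>.
  Invariance then transports the form found at \<open>p\<close>, with the same units, to every
  point.\<close>

lemma homogeneous_metric_diagonal:
  fixes g :: "(quat ^ 'm::finite) tensor02"
  assumes g: "g \<in> homogeneous_metrics" and p: "p \<in> sphere 0 1" and u0: "herm p u0 = 0" "u0 \<bullet> u0 = 1"
  shows "\<exists>e1 e2. e1 \<bullet> qone = 0 \<and> e2 \<bullet> qone = 0 \<and> e1 \<bullet> e1 = 1 \<and> e2 \<bullet> e2 = 1 \<and> e1 \<bullet> e2 = 0 \<and>
    g = quat_triple.metric (rmul e1) (rmul e2) (rmul (qmult e2 e1)) (g p u0 u0)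
      (g p (rmul e1 p) (rmul e1 p) / g p u0 u0 - 1) (g p (rmul e2 p) (rmul e2 p) / g p u0 u0 - 1)
      (g p (rmul (qmult e2 e1) p) (rmul (qmult e2 e1) p) / g p u0 u0 - 1)"
proof -
  have riem: "riemannian_metric g" using g by (simp add: homogeneous_metrics_def)
  define S where "S = g p u0 u0"
  have "u0 \<in> tangent p" "u0 \<noteq> 0" using u0 horizontal_tangent by auto
  then have "S > 0" using riem p by (simp add: riemannian_metric_def S_def)
  define B where "B e f = g p (tangent_proj p (rmul e p)) (tangent_proj p (rmul f p))" for e f
  note bil = bilinear_riemannian[OF riem p] and tp = tangent_proj_tangent[OF p]
  have B: "bilinear B"
    unfolding bilinear_def B_def
    by (intro conjI allI linearI; simp only: rmul_linear bilinear_ladd[OF bil] bilinear_radd[OF bil]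
        bilinear_lmul[OF bil] bilinear_rmul[OF bil])
  have Bimag: "B e f = g p (rmul e p) (rmul f p)" if "e \<bullet> qone = 0" "f \<bullet> qone = 0" for e f
    using that by (simp add: B_def tangent_proj_linear rmul_tangent)
  have Bsym: "B e f = B f e" for e f
    unfolding B_def by (rule riemannian_linear(5)[OF riem p tp tp tp])
  let ?V = "{e. e \<bullet> qone = 0}"
  have V: "subspace ?V" by (rule subspace_hyperplane2)
  obtain x where x: "x \<in> ?V" "x \<noteq> 0" using exists_imaginary_orthogonal[of 0] by auto
  obtain e1 where e1: "e1 \<bullet> qone = 0" "norm e1 = 1" "\<And>f. f \<bullet> qone = 0 \<Longrightarrow> f \<bullet> e1 = 0 \<Longrightarrow> B e1 f = 0"
    using bilinear_eigenvector[OF B Bsym V x] by auto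
  have V': "subspace (?V \<inter> {e. e \<bullet> e1 = 0})" by (intro subspace_inter subspace_hyperplane2)
  obtain y where y: "y \<in> ?V \<inter> {e. e \<bullet> e1 = 0}" "y \<noteq> 0" using exists_imaginary_orthogonal[of e1] by
      auto
  obtain e2 where e2: "e2 \<bullet> qone = 0" "e2 \<bullet> e1 = 0" "norm e2 = 1"
      "\<And>f. f \<bullet> qone = 0 \<Longrightarrow> f \<bullet> e1 = 0 \<Longrightarrow> f \<bullet> e2 = 0 \<Longrightarrow> B e2 f = 0"
    using bilinear_eigenvector[OF B Bsym V' y] by auto
  define e3 where "e3 = qmult e2 e1"
  have e: "e1 \<bullet> qone = 0" "e2 \<bullet> qone = 0" "e1 \<bullet> e1 = 1" "e2 \<bullet> e2 = 1" "e1 \<bullet> e2 = 0"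
    using e1 e2 by (simp_all add: dot_square_norm inner_commute)
  note e3 = qmult_orthonormal[OF e, folded e3_def]
  \<comment> \<open>\<open>e3\<close> is imaginary and orthogonal to \<open>e1\<close> and
    \<open>e2\<close>, so the third eigenvector comes for free.\<close>
  have B0: "B e1 e2 = 0" "B e1 e3 = 0" "B e2 e3 = 0"
    using e1(3)[OF e2(1,2)] e1(3)[OF e3(1,3)] e2(4)[OF e3(1,3,4)] by auto
  interpret T: quat_triple "rmul e1" "rmul e2" "rmul (qmult e2 e1) :: quat ^ 'm \<Rightarrow> _"
    by (rule quat_triple_rmul[OF e])
  have "g q v w = T.metric S (B e1 e1 / S - 1) (B e2 e2 / S - 1) (B e3 e3 / S - 1) q v w" for q v w
  proof (cases "q \<in> sphere 0 1 \<and> v \<in> tangent q \<and> w \<in> tangent q")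
    case True
    then have q: "q \<in> sphere 0 1" and v: "v \<in> tangent q" and w: "w \<in> tangent q" by auto
    then have qq: "q \<bullet> q = 1" by (simp add: dot_square_norm)
    define G where "G v w = g q (tangent_proj q v) (tangent_proj q w)" for v w
    note tq = tangent_proj_tangent[OF q]
    have G: "bilinear G" unfolding G_def[abs_def] by (rule bilinear_riemannian[OF riem q])
    have Gt: "G v w = g q v w" if "v \<in> tangent q" "w \<in> tangent q" for v w
      using that by (simp add: G_def tangent_proj_linear)
    have Gsym: "G v w = G w v" for v w
      unfolding G_def by (rule riemannian_linear(5)[OF riem q tq tq tq])
    define X1 X2 X3 where "X1 = rmul e1 q" and "X2 = rmul e2 q" and "X3 = rmul e3 q"
    have X: "X1 \<in> tangent q" "X2 \<in> tangent q" "X3 \<in> tangent q"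
      unfolding X1_def X2_def X3_def by (intro rmul_tangent e e3)+
    have XX: "X1 \<bullet> X1 = 1" "X2 \<bullet> X2 = 1" "X3 \<bullet> X3 = 1" "X1 \<bullet> X2 = 0" "X1 \<bullet> X3 = 0" "X2 \<bullet> X3 = 0"
      unfolding X1_def X2_def X3_def rmul_inner_rmul qq using e e3 by (simp_all add: inner_commute)
    have GX: "G (rmul e q) (rmul f q) = B e f" if "e \<bullet> qone = 0" "f \<bullet> qone = 0" for e f
      using that by (simp add: Gt rmul_tangent Bimag homogeneous_metric_vertical[OF g p q])
    have GXX: "G X1 X1 = B e1 e1" "G X2 X2 = B e2 e2" "G X3 X3 = B e3 e3"
      "G X1 X2 = 0" "G X1 X3 = 0" "G X2 X3 = 0" "G X2 X1 = 0" "G X3 X1 = 0" "G X3 X2 = 0"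
      using B0 Bsym unfolding X1_def X2_def X3_def by (simp_all add: GX e e3)
    \<comment> \<open>Horizontal part: it is orthogonal to \<open>X1\<close>, \<open>X2\<close>,
      \<open>X3\<close>, and to \<open>q\<close> if \<open>v\<close> is tangent, so
      \<open>herm q (h v)\<close> is orthogonal to a basis of the quaternions.\<close>
    define h where "h v = v - (v \<bullet> X1) *\<^sub>R X1 - (v \<bullet> X2) *\<^sub>R X2 - (v \<bullet> X3) *\<^sub>R X3" for v
    have hX: "h v \<bullet> X1 = 0" "h v \<bullet> X2 = 0" "h v \<bullet> X3 = 0" for v
      using XX by (simp_all add: h_def inner_diff_left inner_commute[of X2 X1]
          inner_commute[of X3 X1] inner_commute[of X3 X2])
    have hor: "herm q (h v) = 0" if "v \<in> tangent q" for v
    proof (rule quaternion_orthogonal_basis[OF e])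
      show "herm q (h v) \<bullet> e1 = 0" "herm q (h v) \<bullet> e2 = 0" "herm q (h v) \<bullet> qmult e2 e1 = 0"
        using hX[of v] unfolding X1_def X2_def X3_def e3_def
        by (simp_all add: rmul_inner[symmetric] inner_commute)
      have "q \<bullet> h v = 0"
        using that X by (simp add: h_def tangent_def inner_diff_right inner_commute)
      then show "herm q (h v) \<bullet> qone = 0" by (simp add: inner_herm inner_commute)
    qed
    have ht: "h v \<in> tangent q" if "v \<in> tangent q" for v by (intro horizontal_tangent hor that)
    have GhX: "G (h v) X1 = 0" "G (h v) X2 = 0" "G (h v) X3 = 0" if "v \<in> tangent q" for v
      using homogeneous_metric_cross[OF g q hor[OF that]] Gt[OF ht[OF that]] X e e3
      by (auto simp: X1_def X2_def X3_def)
    have GXh: "G X1 (h w) = 0" "G X2 (h w) = 0" "G X3 (h w) = 0"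
      using GhX[OF w] by (simp_all only: Gsym[of _ "h w"])
    have Ghh: "G (h v) (h w) = S * (h v \<bullet> h w)"
      using homogeneous_metric_horizontal[OF g p q u0 hor[OF v] hor[OF w]] Gt ht v w by
          (simp add: S_def)
    have hh: "h v \<bullet> h w = v \<bullet> w - (v \<bullet> X1) * (w \<bullet> X1) - (v \<bullet> X2) * (w \<bullet> X2) - (v \<bullet> X3) * (w \<bullet> X3)"
    proof -
      have "h v \<bullet> h w = h v \<bullet> w" using hX[of v] by (simp add: h_def[of w] inner_diff_right)
      also have "\<dots> = v \<bullet> w - (v \<bullet> X1) * (w \<bullet> X1) - (v \<bullet> X2) * (w \<bullet> X2) - (v \<bullet> X3) * (w \<bullet> X3)"
        by (simp add: h_def inner_diff_left inner_commute[of X1 w] inner_commute[of X2 w]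
            inner_commute[of X3 w])
      finally show ?thesis .
    qed
    have dec: "v = h v + (v \<bullet> X1) *\<^sub>R X1 + (v \<bullet> X2) *\<^sub>R X2 + (v \<bullet> X3) *\<^sub>R X3" for v
      by (simp add: h_def)
    have "g q v w = G v w" using Gt v w by simp
    also have "\<dots> = G (h v + (v \<bullet> X1) *\<^sub>R X1 + (v \<bullet> X2) *\<^sub>R X2 + (v \<bullet> X3) *\<^sub>R X3)
        (h w + (w \<bullet> X1) *\<^sub>R X1 + (w \<bullet> X2) *\<^sub>R X2 + (w \<bullet> X3) *\<^sub>R X3)"
      by (simp only: dec[symmetric])
    also have "\<dots> = S * (h v \<bullet> h w) + (v \<bullet> X1) * (w \<bullet> X1) * B e1 e1 + (v \<bullet> X2) * (w \<bullet> X2) * B e2 e2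
        + (v \<bullet> X3) * (w \<bullet> X3) * B e3 e3"
      by (simp add: bilinear_ladd[OF G] bilinear_radd[OF G] bilinear_lmul[OF G] bilinear_rmul[OF G]
        GXX GhX[OF v] GXh Ghh)
    also have "\<dots> = T.metric S (B e1 e1 / S - 1) (B e2 e2 / S - 1) (B e3 e3 / S - 1) q v w"
      using True \<open>S > 0\<close> unfolding hh
      by (simp add: T.metric_def restrict_tensor_def X1_def X2_def X3_def e3_def field_simps)
    finally show ?thesis .
  next
    case False
    have "restrict_tensor g = g" using riem by (simp add: riemannian_metric_def)
    then have "g q v w = restrict_tensor g q v w" by simp
    then show ?thesis using False by (auto simp: T.metric_def restrict_tensor_def)
  qed
  then have "g = T.metric S (B e1 e1 / S - 1) (B e2 e2 / S - 1) (B e3 e3 / S - 1)" by (intro ext)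
  then show ?thesis
    using e by (intro exI[of _ e1] exI[of _ e2]) (simp add: Bimag e3 e3_def[symmetric] S_def)
qed

text \<open>The right multiples of \<open>p\<close> span at most 4 of the 4 CARD('m) real
  dimensions, and orthogonality to all of them is the vanishing of \<open>herm p\<close>.\<close>

lemma exists_horizontal:
  fixes p :: "quat ^ 'm::finite"
  assumes "CARD('m) \<ge> 2"
  shows "\<exists>u. herm p u = 0 \<and> u \<bullet> u = 1"
proof -
  have lin: "linear (\<lambda>e. rmul e p)" by (rule linearI) (simp_all add: rmul_linear)
  have "dim (range (\<lambda>e. rmul e p)) \<le> dim (UNIV :: quat set)" by (rule dim_image_le[OF lin])
  also have "\<dots> < DIM(quat ^ 'm)" using assms by simp
  finally have "dim (range (\<lambda>e. rmul e p)) < DIM(quat ^ 'm)" .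
  from orthogonal_to_subspace_exists[OF this] obtain x where x: "x \<noteq> 0"
      "\<And>y. y \<in> span (range (\<lambda>e. rmul e p)) \<Longrightarrow> orthogonal x y" by auto
  have "e \<bullet> herm p x = 0" for e
    using x(2)[OF span_base[of "rmul e p"]] rmul_inner[of e p x] inner_commute[of x "rmul e p"]
    by (simp add: orthogonal_def)
  then have "herm p x = 0" by (metis inner_eq_zero_iff)
  then show ?thesis using x(1)
    by (intro exI[of _ "x /\<^sub>R norm x"]) (simp add: herm_simps dot_square_norm power2_eq_square)
qed

lemma round_metric_homogeneous: "round_metric \<in> (homogeneous_metrics :: (quat ^ 'm::finite)
    tensor02 set)"
proof -
  define i j :: quat where "i = (\<i>, 0)" and "j = (0, 1)"
  interpret T: quat_triple "rmul i :: quat ^ 'm \<Rightarrow> _" "rmul j" "rmul (qmult j i)"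
    by (rule quat_triple_rmul) (simp_all add: i_def j_def quat_expand)
  have "round_metric = T.metric 1 0 0 0" by (simp add: round_metric_def T.metric_def)
  then have "riemannian_metric (round_metric :: (quat ^ 'm) tensor02)"
    using T.riemannian_metric_metric[of 1 0 0 0] by simp
  moreover have "Sp_invariant (round_metric :: (quat ^ 'm) tensor02)"
    unfolding Sp_invariant_def
  proof (intro ballI)
    fix A :: "quat ^ 'm ^ 'm" and p v w :: "quat ^ 'm"
    assume A: "A \<in> Sp" and "p \<in> sphere 0 1" "v \<in> tangent p" "w \<in> tangent p"
    then have "qmat_vec A p \<in> sphere 0 1" "qmat_vec A v \<in> tangent (qmat_vec A p)" "qmat_vec A w \<in>
        tangent (qmat_vec A p)"
      using inner_qmat_vec[OF A] by (auto simp: tangent_def norm_eq_sqrt_inner)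
    then show "round_metric (qmat_vec A p) (qmat_vec A v) (qmat_vec A w) = round_metric p v w"
      using \<open>p \<in> _\<close> \<open>v \<in> _\<close> \<open>w \<in> _\<close> by (simp add: round_metric_def restrict_tensor_def
          inner_qmat_vec[OF A])
  qed
  ultimately show ?thesis by (simp add: homogeneous_metrics_def)
qed

theorem theoremC:
  fixes n :: nat and p :: "quat ^ 'm::finite"
  assumes "n \<ge> 1" and "CARD('m) = n + 1" and "p \<in> sphere 0 1"
  shows "\<exists>\<O>. openin (homogeneous_metric_topology p) \<O> \<and> round_metric \<in> \<O> \<and>
           (\<forall>g0\<in>\<O>. \<exists>c>0. \<exists>g. ricci_iteration_from (scale_tensor c g0) g \<and>
              (\<exists>h. riemannian_metric h \<and> constant_curvature h \<and> smooth_converges g h))"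
proof -
  have card: "CARD('m) \<ge> 2" using assms by simp
  have dim: "DIM(quat ^ 'm) \<ge> 8" using card by simp
  obtain u0 where u0: "herm p u0 = 0" "u0 \<bullet> u0 = 1" using exists_horizontal[OF card] by blast
  have "real DIM(quat ^ 'm) \<ge> 8" using dim by linarith
  from shape_map_backward_orbit[OF this] obtain \<delta> where \<delta>: "\<delta> > 0"
    "\<And>y. y \<in> ball 0 \<delta> \<Longrightarrow> \<exists>z. z 0 = y \<and> (\<forall>i. shape_map DIM(quat ^ 'm) (z (Suc i)) = z i) \<and>
    (\<forall>i. z i \<in> ball 0 (1/4)) \<and> z \<longlonglongrightarrow> 0" by auto
  \<comment> \<open>The projection keeps \<open>X\<close> linear on all quaternions with tangent
    values; it sends the real unit, whose multiple is \<open>p\<close> itself, to 0.\<close>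
  define X where "X b = tangent_proj p (rmul b p)" for b
  \<comment> \<open>Deviation of the vertical part from the multiple of the round form set by the
    horizontal scale \<phi> u0 u0; it depends on finitely many evaluations, which are continuous in
    the product topology.\<close>
  define W where "W \<phi> = (\<Sum>b\<in>Basis. \<Sum>b'\<in>Basis. \<bar>\<phi> (X b) (X b') - \<phi> u0 u0 * (X b \<bullet> X b')\<bar>)"
    for \<phi> :: "quat ^ 'm \<Rightarrow> quat ^ 'm \<Rightarrow> real"
  \<comment> \<open>Both sides scale alike with \<phi>. Each |k_a| is at most \<open>W\<close> /
    (\<phi> u0 u0) < \<delta> / 3, so the three coordinates together give a shape of norm below
    \<delta>.\<close>
  define U where "U = {\<phi>. 3 * W \<phi> < \<delta> * \<phi> u0 u0}"
  define O' where "O' = (\<lambda>g. g p) -` U \<inter> homogeneous_metrics"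
  have ev: "continuous_on UNIV (\<lambda>\<phi> :: quat ^ 'm \<Rightarrow> quat ^ 'm \<Rightarrow> real. \<phi> a b)" for a b
    by (rule continuous_on_product_then_coordinatewise[OF continuous_on_product_coordinates])
  have "open U"
    unfolding U_def W_def by (intro open_Collect_less continuous_intros ev)
  then have "openin (homogeneous_metric_topology p) O'"
    unfolding homogeneous_metric_topology_def openin_pullback_topology O'_def by auto
  moreover have "round_metric \<in> O'"
  proof -
    have "round_metric p v w = v \<bullet> w" if "v \<in> tangent p" "w \<in> tangent p" for v w :: "quat ^ 'm"
      using that assms(3) by (simp add: round_metric_def restrict_tensor_def)
    then have "round_metric p u0 u0 = 1" "W (round_metric p) = 0"
      using u0 assms(3) by (simp_all add: W_def X_def tangent_proj_tangent horizontal_tangent)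
    then show ?thesis using \<delta>(1) round_metric_homogeneous by (simp add: O'_def U_def)
  qed
  moreover have "\<exists>c>0. \<exists>g. ricci_iteration_from (scale_tensor c g0) g \<and>
      (\<exists>h. riemannian_metric h \<and> constant_curvature h \<and> smooth_converges g h)" if "g0 \<in> O'" for g0
  proof -
    have g0: "g0 \<in> homogeneous_metrics" and W: "3 * W (g0 p) < \<delta> * g0 p u0 u0"
      using that by (auto simp: O'_def U_def)
    have riem: "riemannian_metric g0" using g0 by (simp add: homogeneous_metrics_def)
    define S where "S = g0 p u0 u0"
    have "u0 \<in> tangent p" "u0 \<noteq> 0" using u0 horizontal_tangent by auto
    then have S: "S > 0" using riem assms(3) by (simp add: riemannian_metric_def S_def)
    have "p \<bullet> p = 1" using assms(3) by (simp add: dot_square_norm)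
    define k where "k e = g0 p (rmul e p) (rmul e p) / S - 1" for e
    obtain e1 e2 where e: "e1 \<bullet> qone = 0" "e2 \<bullet> qone = 0" "e1 \<bullet> e1 = 1" "e2 \<bullet> e2 = 1" "e1 \<bullet> e2 = 0"
      and g0_eq: "g0 = quat_triple.metric (rmul e1) (rmul e2) (rmul (qmult e2 e1)) S (k e1) (k e2)
          (k (qmult e2 e1))"
      using homogeneous_metric_diagonal[OF g0 assms(3) u0] unfolding k_def S_def by blast
    interpret T: quat_triple "rmul e1" "rmul e2" "rmul (qmult e2 e1) :: quat ^ 'm \<Rightarrow> _"
      by (rule quat_triple_rmul[OF e])
    define B where "B e f = g0 p (X e) (X f) - S * (X e \<bullet> X f)" for e f
    note t = tangent_proj_tangent[OF assms(3)]
    have "bilinear B"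
      unfolding bilinear_def B_def X_def
      by (intro conjI allI linearI; simp only: rmul_linear tangent_proj_linear
          riemannian_linear(1)[OF riem assms(3) t t t] riemannian_linear(2)[OF riem assms(3) t t t]
          riemannian_linear(3)[OF riem assms(3) t t t] riemannian_linear(4)[OF riem assms(3) t t t]
          inner_add_left inner_add_right inner_scaleR_left inner_scaleR_right real_scaleR_def;
          simp add: algebra_simps)
    have k: "\<bar>k e\<bar> < \<delta> / 3" if e: "e \<bullet> qone = 0" "e \<bullet> e = 1" for e
    proof -
      have "norm e = 1" using e(2) by (simp add: norm_eq_sqrt_inner)
      from bilinear_abs_le[OF \<open>bilinear B\<close> this] have "\<bar>B e e\<bar> \<le> W (g0 p)"
        by (simp only: W_def B_def S_def)
      moreover have "B e e = S * k e"
        using S e \<open>p \<bullet> p = 1\<close>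
        by (simp add: B_def X_def k_def tangent_proj_linear rmul_tangent rmul_inner_rmul
            field_simps)
      ultimately have "S * \<bar>k e\<bar> \<le> W (g0 p)" using S by (simp add: abs_mult)
      then have "3 * (S * \<bar>k e\<bar>) < \<delta> * S" using W unfolding S_def by linarith
      then have "S * (3 * \<bar>k e\<bar>) < S * \<delta>" by (simp only: mult.commute mult.left_commute)
      then show ?thesis using S by simp
    qed
    let ?y = "(k e1, k e2, k (qmult e2 e1))"
    have "norm ?y \<le> \<bar>k e1\<bar> + (\<bar>k e2\<bar> + \<bar>k (qmult e2 e1)\<bar>)"
      using norm_Pair_le[of "k e1" "(k e2, k (qmult e2 e1))"]
          norm_Pair_le[of "k e2" "k (qmult e2 e1)"] by simp
    also have "\<dots> < \<delta>"
      using k[OF e(1,3)] k[OF e(2,4)] k[OF qmult_orthonormal(1,2)[OF e]] by simp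
    finally have "?y \<in> ball 0 \<delta>" by simp
    from \<delta>(2)[OF this] obtain z where z: "z 0 = ?y" "\<And>i. shape_map DIM(quat ^ 'm) (z (Suc i)) = z i"
      "\<And>i. z i \<in> ball 0 (1/4)" "z \<longlonglongrightarrow> 0" by blast
    show ?thesis
      using T.ricci_iteration_metric[OF S dim z(2-4)] unfolding z(1) fst_conv snd_conv
          g0_eq[symmetric] .
  qed
  ultimately show ?thesis by (intro exI[of _ O'] conjI ballI)
qed

end
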